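(* Let $\varepsilon\in(0,1/2]$ and let $\mathcal{F}$ be a family of bicolored graphs. The following are equivalent: (1) $\mathrm{ex}(\varepsilon,\mathcal{F})<1$; (2) $R(\varepsilon,\mathcal{F})<\infty$; (3) there exist $F,G\in\mathcal{F}$ (possibly $F=G$) such that $F$ is contained in some Type 1 unavoidable $t$-graph and $G$ is contained in some Type 2 unavoidable $t$-graph.
   Context: A bicolored graph is a simple graph whose edges are each colored red or blue. A bicolored graph $G$ is $\varepsilon$-balanced if each color class contains at least $\varepsilon\cdot e(G)$ edges. $G$ contains $F$ if there is an injective map $V(F)\to V(G)$ sending every edge of $F$ to an edge of $G$ of the same color. An unavoidable $t$-graph is a bicolored $K_{2t}$ in which one color class is either a clique on $t$ vertices (Type 1) or two vertex-disjoint cliques on $t$ vertices each (Type 2), all other edges having the other color. For a family $\mathcal{F}$, $\mathrm{ex}(\varepsilon,n,\mathcal{F})$ is the maximum number of edges of an $n$-vertex $\varepsilon$-balanced bicolored graph containing no member of $\mathcal{F}$, and $\mathrm{ex}(\varepsilon,\mathcal{F}):=\lim_{n\to\infty}\mathrm{ex}(\varepsilon,n,\mathcal{F})/\binom{n}{2}$. $R(\varepsilon,\mathcal{F})$ is the smallest integer $N$ such that every $\varepsilon$-balanced bicolored complete graph on at least $N$ vertices contains some member of $\mathcal{F}$, and $R(\varepsilon,\mathcal{F})=\infty$ if no such $N$ exists.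
   Formalization: Condition (3) is required for each colour c of the distinguished class (F, G may depend on c); with that colour free, (3) does not imply (2): take F = K_4 with one red edge, G = K_4 with a red perfect matching, and hosts made of a blue clique with all other edges red. *)

theory Defs
  imports Complex_Main "HOL-Library.Extended_Nat"
begin

datatype colour = Red | Blue

record 'a bigraph =
  verts :: "'a set"
  colour_class :: "colour \<Rightarrow> 'a set set"

definition pairs :: "'a set \<Rightarrow> 'a set set" where
  "pairs A = {e. e \<subseteq> A \<and> card e = 2}"

definition edges :: "'a bigraph \<Rightarrow> 'a set set" where
  "edges G = colour_class G Red \<union> colour_class G Blue"

definition bicolored :: "'a bigraph \<Rightarrow> bool" where
  "bicolored G \<longleftrightarrow> finite (verts G) \<and> edges G \<subseteq> pairs (verts G) \<and>
     colour_class G Red \<inter> colour_class G Blue = {}"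

definition complete_graph :: "'a bigraph \<Rightarrow> bool" where
  "complete_graph G \<longleftrightarrow> edges G = pairs (verts G)"

definition balanced :: "real \<Rightarrow> 'a bigraph \<Rightarrow> bool" where
  "balanced \<epsilon> G \<longleftrightarrow> (\<forall>c. \<epsilon> * real (card (edges G)) \<le> real (card (colour_class G c)))"

definition contains :: "'a bigraph \<Rightarrow> 'b bigraph \<Rightarrow> bool" where
  "contains G F \<longleftrightarrow> (\<exists>f. inj_on f (verts F) \<and> f ` verts F \<subseteq> verts G \<and>
     (\<forall>c. \<forall>e\<in>colour_class F c. f ` e \<in> colour_class G c))"

text \<open>
  In an unavoidable graph "one color class" may be either one, and exchanging the two colours
  does not preserve the isomorphism type. The parameter \<open>c\<close> is the colour of the class made up
  of one clique (Type 1) or of two disjoint cliques (Type 2).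
\<close>

definition unavoidable_type1 :: "colour \<Rightarrow> nat \<Rightarrow> 'a bigraph \<Rightarrow> bool" where
  "unavoidable_type1 c t H \<longleftrightarrow> t \<ge> 1 \<and> bicolored H \<and> complete_graph H \<and> card (verts H) = 2 * t \<and>
     (\<exists>A\<subseteq>verts H. card A = t \<and> colour_class H c = pairs A)"

definition unavoidable_type2 :: "colour \<Rightarrow> nat \<Rightarrow> 'a bigraph \<Rightarrow> bool" where
  "unavoidable_type2 c t H \<longleftrightarrow> t \<ge> 1 \<and> bicolored H \<and> complete_graph H \<and> card (verts H) = 2 * t \<and>
     (\<exists>A B. A \<subseteq> verts H \<and> B \<subseteq> verts H \<and> A \<inter> B = {} \<and> card A = t \<and> card B = t \<and>
        colour_class H c = pairs A \<union> pairs B)"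

text \<open>
  Host graphs have vertices in \<open>nat\<close>; up to isomorphism these are all finite graphs. The
  supremum is over a finite set of numbers, so it is a maximum; it is \<open>0\<close> if no \<open>n\<close>-vertex graph
  qualifies, which happens only if the family has an edgeless member on at most \<open>n\<close> vertices.
\<close>

definition ex_number :: "real \<Rightarrow> nat \<Rightarrow> 'a bigraph set \<Rightarrow> nat" where
  "ex_number \<epsilon> n \<F> = Sup {card (edges G) | G :: nat bigraph.
     bicolored G \<and> card (verts G) = n \<and> balanced \<epsilon> G \<and> (\<forall>F\<in>\<F>. \<not> contains G F)}"

definition ex_density :: "real \<Rightarrow> 'a bigraph set \<Rightarrow> real" where
  "ex_density \<epsilon> \<F> = lim (\<lambda>n. real (ex_number \<epsilon> n \<F>) / real (n choose 2))"

definition ramsey_number :: "real \<Rightarrow> 'a bigraph set \<Rightarrow> enat" where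
  "ramsey_number \<epsilon> \<F> = Inf {enat N | N.
     \<forall>G :: nat bigraph. bicolored G \<and> complete_graph G \<and> balanced \<epsilon> G \<and> N \<le> card (verts G)
       \<longrightarrow> (\<exists>F\<in>\<F>. contains G F)}"

text \<open>
  A finite Ramsey number requires members of the family inside both types for either colour \<open>c\<close>
  of the distinguished class; the members may depend on \<open>c\<close>. For a family that is invariant under
  exchanging the colours, one \<open>c\<close> for each type is enough, but in general it is not. Let \<open>F\<close> be
  \<open>K\<^sub>4\<close> with exactly one red edge (Type 1), \<open>G\<close> be \<open>K\<^sub>4\<close> whose red edges form a perfect matching
  (Type 2), and \<open>\<epsilon> < 1/2\<close>. A complete graph consisting of a blue clique, with all other edges red,
  contains neither, and arbitrarily large ones are \<open>\<epsilon>\<close>-balanced.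
\<close>

end

theory Submission
  imports Defs "HOL-Library.Ramsey" "HOL-Real_Asymp.Real_Asymp"
begin

text \<open>
  By a second moment computation, some \<open>m\<close>-subset of the vertices of a bicolored graph reproduces
  both colour densities up to \<open>O(m\<^sup>-\<^sup>1\<^sup>/\<^sup>2)\<close>. After deleting a few edges to restore exact balance,
  this shows that the density of extremal graphs is almost decreasing in \<open>n\<close>, so that its limit
  exists. If there are arbitrarily large balanced complete graphs without a member of the family,
  the limit is 1, so (1) implies (2). For (2) to (3), there are arbitrarily large complete graphs
  of either type whose two colour classes have exactly the same size, and these are balanced for
  all \<open>\<epsilon> \<le> 1 / 2\<close>. For (3) to (1), a sample of constant size from a balanced graph of density close
  to 1 is complete and still balanced, and large balanced complete graphs contain large graphs of
  one of the types by Ramsey's theorem.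
\<close>

subsection \<open>Bicolored graphs and split graphs\<close>

text \<open>Averaging over induced subgraphs, the usual proof that Turan densities exist, fails
  here: an induced subgraph of a balanced graph need not be balanced, and a sample with many edges
  may be monochromatic. One sample must be good for both colours at once, which calls for
  concentration instead of expectation. The resulting error of order m^(3/2) edges is negligible
  against \<open>m choose 2\<close>. Sampling disturbs balance slightly, and its two uses repair
  this differently. For the limit, \<epsilon> must be kept exactly, but edges may be deleted. For
  (3) to (1) the sample must stay complete; there balance is relaxed to \<epsilon>/2, which is
  harmless because (3) does not mention \<epsilon>. An unavoidable t-graph is itself never
  1/2-balanced, so (2) to (3) needs patterns whose parts have unequal sizes. Equal parts are
  recovered afterwards by enlarging both.\<close>

lemma finite_pairs: "finite A \<Longrightarrow> finite (pairs A)"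
  unfolding pairs_def by simp

lemma card_pairs: "finite A \<Longrightarrow> card (pairs A) = card A choose 2"
  unfolding pairs_def by (rule n_subsets)

lemma pairs_mono: "A \<subseteq> B \<Longrightarrow> pairs A \<subseteq> pairs B"
  unfolding pairs_def by auto

lemma pairs_Int: "pairs A \<inter> pairs B = pairs (A \<inter> B)"
  unfolding pairs_def by auto

lemma pairs_disjoint: "A \<inter> B = {} \<Longrightarrow> pairs A \<inter> pairs B = {}"
  unfolding pairs_Int by (auto simp: pairs_def)

lemma pairsE:
  assumes "e \<in> pairs A"
  obtains x y where "e = {x, y}" "x \<in> A" "y \<in> A" "x \<noteq> y"
  using assms unfolding pairs_def by (auto simp: card_2_iff)

lemma image_in_pairs_iff:
  assumes "inj_on f S" "e \<subseteq> S"
  shows "f ` e \<in> pairs B \<longleftrightarrow> f ` e \<subseteq> B \<and> e \<in> pairs S"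
  using assms card_image[OF inj_on_subset[OF assms]] by (auto simp: pairs_def)

primrec opp :: "colour \<Rightarrow> colour" where
  "opp Red = Blue"
| "opp Blue = Red"

lemma opp_neq [simp]: "opp c \<noteq> c" "c \<noteq> opp c"
  by (cases c; simp)+

lemma opp_opp [simp]: "opp (opp c) = c"
  by (cases c) simp_all

lemma neq_iff_eq_opp: "d \<noteq> c \<longleftrightarrow> d = opp c"
  by (cases c; cases d) simp_all

lemma edges_eq: "edges G = colour_class G c \<union> colour_class G (opp c)"
  unfolding edges_def by (cases c) auto

lemma class_subset_edges: "colour_class G c \<subseteq> edges G"
  using edges_eq[of G c] by blast

lemma bicolored_iff:
  "bicolored G \<longleftrightarrow> finite (verts G) \<and> edges G \<subseteq> pairs (verts G) \<and>
     colour_class G c \<inter> colour_class G (opp c) = {}"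
  unfolding bicolored_def by (cases c) auto

lemma bicoloredD:
  assumes "bicolored G"
  shows "finite (verts G)" "colour_class G c \<subseteq> pairs (verts G)" "finite (colour_class G c)"
    "colour_class G c \<inter> colour_class G (opp c) = {}"
    "card (edges G) = card (colour_class G c) + card (colour_class G (opp c))"
proof -
  show f: "finite (verts G)"
    using assms by (simp add: bicolored_def)
  have sub: "colour_class G d \<subseteq> pairs (verts G)" for d
    using assms class_subset_edges[of G d] unfolding bicolored_def by blast
  have fin: "finite (colour_class G d)" for d
    using finite_subset[OF sub finite_pairs[OF f]] .
  show disj: "colour_class G c \<inter> colour_class G (opp c) = {}"
    using assms unfolding bicolored_def by (cases c) auto
  show "colour_class G c \<subseteq> pairs (verts G)" "finite (colour_class G c)"
    by (rule sub fin)+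
  show "card (edges G) = card (colour_class G c) + card (colour_class G (opp c))"
    unfolding edges_eq[of G c] using fin disj by (simp add: card_Un_disjoint)
qed

lemma card_edges_le: "bicolored G \<Longrightarrow> card (edges G) \<le> card (verts G) choose 2"
  using card_mono[OF finite_pairs, of "verts G" "edges G"]
  by (simp add: bicolored_def card_pairs)

lemma card_edges_complete:
  "bicolored G \<Longrightarrow> complete_graph G \<Longrightarrow> card (edges G) = card (verts G) choose 2"
  by (simp add: complete_graph_def bicolored_def card_pairs)

lemma bicolored_class_sub:
  assumes "bicolored G" "finite (verts H)" "edges H \<subseteq> pairs (verts H)"
    "\<And>c. colour_class H c \<subseteq> colour_class G c"
  shows "bicolored H"
  using assms unfolding bicolored_def by blast

lemma contains_trans: "contains G H \<Longrightarrow> contains H F \<Longrightarrow> contains G F"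
  unfolding contains_def
proof (elim exE conjE)
  fix f g
  assume "inj_on f (verts H)" "f ` verts H \<subseteq> verts G"
    "\<forall>c. \<forall>e\<in>colour_class H c. f ` e \<in> colour_class G c"
    "inj_on g (verts F)" "g ` verts F \<subseteq> verts H"
    "\<forall>c. \<forall>e\<in>colour_class F c. g ` e \<in> colour_class H c"
  then have "inj_on (f \<circ> g) (verts F)" "(f \<circ> g) ` verts F \<subseteq> verts G"
      "\<forall>c. \<forall>e\<in>colour_class F c. (f \<circ> g) ` e \<in> colour_class G c"
    unfolding image_comp [symmetric] by (auto intro: comp_inj_on inj_on_subset) blast+
  then show "\<exists>h. inj_on h (verts F) \<and> h ` verts F \<subseteq> verts G \<and>
      (\<forall>c. \<forall>e\<in>colour_class F c. h ` e \<in> colour_class G c)"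
    by blast
qed

lemma contains_subgraph:
  assumes "verts H \<subseteq> verts G" "\<And>c. colour_class H c \<subseteq> colour_class G c"
  shows "contains G H"
  using assms unfolding contains_def by (intro exI[of _ id]) auto

text \<open>
  The flag \<open>two\<close> selects Type 2 (both parts are cliques of the distinguished colour \<open>c\<close>) instead
  of Type 1 (only \<open>A\<close> is). The parts need not have equal size.
\<close>

definition clique_pairs :: "bool \<Rightarrow> 'a set \<Rightarrow> 'a set \<Rightarrow> 'a set set" where
  "clique_pairs two A B = pairs A \<union> (if two then pairs B else {})"

text \<open>A pattern on two vertex sets of the host, without an embedding, so that the Ramsey
  argument never leaves the host's vertex type; \<open>split_in_contains\<close> converts it to
  containment.\<close>

definition split_in :: "'a bigraph \<Rightarrow> colour \<Rightarrow> bool \<Rightarrow> 'a set \<Rightarrow> 'a set \<Rightarrow> bool" where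
  "split_in G c two A B \<longleftrightarrow> A \<union> B \<subseteq> verts G \<and> A \<inter> B = {} \<and>
     clique_pairs two A B \<subseteq> colour_class G c \<and>
     pairs (A \<union> B) - clique_pairs two A B \<subseteq> colour_class G (opp c)"

definition split_graph :: "colour \<Rightarrow> bool \<Rightarrow> 'a set \<Rightarrow> 'a set \<Rightarrow> 'a bigraph" where
  "split_graph c two A B = \<lparr>verts = A \<union> B, colour_class =
     (\<lambda>d. if d = c then clique_pairs two A B else pairs (A \<union> B) - clique_pairs two A B)\<rparr>"

lemma clique_pairs_subset: "clique_pairs two A B \<subseteq> pairs (A \<union> B)"
  unfolding clique_pairs_def using pairs_mono[of A "A \<union> B"] pairs_mono[of B "A \<union> B"] by auto

lemma split_graph_simps [simp]:
  "verts (split_graph c two A B) = A \<union> B"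
  "colour_class (split_graph c two A B) c = clique_pairs two A B"
  "colour_class (split_graph c two A B) (opp c) = pairs (A \<union> B) - clique_pairs two A B"
  "edges (split_graph c two A B) = pairs (A \<union> B)"
  unfolding edges_eq[of _ c] using clique_pairs_subset[of two A B]
  by (auto simp: split_graph_def)

lemma split_graph_complete:
  assumes "finite A" "finite B"
  shows "bicolored (split_graph c two A B)" "complete_graph (split_graph c two A B)"
  using assms unfolding complete_graph_def bicolored_iff[of _ c] by auto

lemma split_in_split_graph:
  "A \<inter> B = {} \<Longrightarrow> split_in (split_graph c two A B) c two A B"
  unfolding split_in_def by simp

lemma eq_split_graphI:
  assumes "bicolored H" "complete_graph H" "verts H = A \<union> B"
    "colour_class H c = clique_pairs two A B"
  shows "(H :: 'a bigraph) = split_graph c two A B"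
proof -
  have "colour_class H (opp c) = pairs (A \<union> B) - clique_pairs two A B"
    using assms bicoloredD(4)[OF assms(1), of c] edges_eq[of H c]
    unfolding complete_graph_def by auto
  then have "colour_class H d = colour_class (split_graph c two A B) d" for d
    using assms(4) by (cases "d = c") (auto simp: neq_iff_eq_opp)
  with assms(3) show ?thesis
    by (intro bigraph.equality) auto
qed

text \<open>In Type 1 the rest of the vertex set serves as the second part, with all its pairs in
  the other colour. This gives both types the same shape.\<close>

lemma unavoidable_type1_iff:
  "unavoidable_type1 c t H \<longleftrightarrow> t \<ge> 1 \<and> (\<exists>A B. finite A \<and> finite B \<and> A \<inter> B = {} \<and>
     card A = t \<and> card B = t \<and> H = split_graph c False A B)"
proof
  assume H: "unavoidable_type1 c t H"
  then obtain A where A: "A \<subseteq> verts H" "card A = t" "colour_class H c = pairs A"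
    unfolding unavoidable_type1_def by blast
  have fin: "finite (verts H)"
    using H by (simp add: unavoidable_type1_def bicolored_def)
  have "card (verts H - A) = t"
    using H A fin by (simp add: unavoidable_type1_def card_Diff_subset finite_subset)
  moreover have "H = split_graph c False A (verts H - A)"
    using H A by (intro eq_split_graphI) (auto simp: unavoidable_type1_def clique_pairs_def)
  ultimately show "t \<ge> 1 \<and> (\<exists>A B. finite A \<and> finite B \<and> A \<inter> B = {} \<and>
     card A = t \<and> card B = t \<and> H = split_graph c False A B)"
    using H A fin finite_subset[OF A(1) fin] unfolding unavoidable_type1_def
    by (intro conjI exI[of _ A] exI[of _ "verts H - A"]) auto
next
  assume "t \<ge> 1 \<and> (\<exists>A B. finite A \<and> finite B \<and> A \<inter> B = {} \<and>
     card A = t \<and> card B = t \<and> H = split_graph c False A B)"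
  then show "unavoidable_type1 c t H"
    unfolding unavoidable_type1_def
    by (auto simp: split_graph_complete card_Un_disjoint clique_pairs_def)
qed

lemma unavoidable_type2_iff:
  "unavoidable_type2 c t H \<longleftrightarrow> t \<ge> 1 \<and> (\<exists>A B. finite A \<and> finite B \<and> A \<inter> B = {} \<and>
     card A = t \<and> card B = t \<and> H = split_graph c True A B)"
proof
  assume H: "unavoidable_type2 c t H"
  then obtain A B where A: "A \<subseteq> verts H" "B \<subseteq> verts H" "A \<inter> B = {}" "card A = t" "card B = t"
      "colour_class H c = pairs A \<union> pairs B"
    unfolding unavoidable_type2_def by blast
  have fin: "finite (verts H)"
    using H by (simp add: unavoidable_type2_def bicolored_def)
  then have fAB: "finite A" "finite B"
    using A finite_subset by blast+
  \<comment> \<open>Two disjoint cliques of size \<open>t\<close> exhaust the \<open>2 * t\<close>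
    vertices.\<close>
  have "A \<union> B = verts H"
    using A H fin fAB by (intro card_subset_eq) (auto simp: card_Un_disjoint unavoidable_type2_def)
  then have "H = split_graph c True A B"
    using H A by (intro eq_split_graphI) (auto simp: unavoidable_type2_def clique_pairs_def)
  then show "t \<ge> 1 \<and> (\<exists>A B. finite A \<and> finite B \<and> A \<inter> B = {} \<and>
     card A = t \<and> card B = t \<and> H = split_graph c True A B)"
    using H A fAB unfolding unavoidable_type2_def by blast
next
  assume "t \<ge> 1 \<and> (\<exists>A B. finite A \<and> finite B \<and> A \<inter> B = {} \<and>
     card A = t \<and> card B = t \<and> H = split_graph c True A B)"
  then obtain A B where "t \<ge> 1" "finite A" "finite B" "A \<inter> B = {}" "card A = t" "card B = t"
      "H = split_graph c True A B"
    by blast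
  then show "unavoidable_type2 c t H"
    unfolding unavoidable_type2_def
    by (intro conjI exI[of _ A] exI[of _ B])
      (auto simp: split_graph_complete card_Un_disjoint clique_pairs_def)
qed

text \<open>Only the sizes of the parts matter. An injection that takes \<open>A\<close> into
  \<open>A'\<close> and \<open>B\<close> into \<open>B'\<close> preserves the colouring, as a pair
  lies within a part exactly when its image lies within the corresponding part.\<close>

lemma split_in_contains:
  assumes G: "split_in G c two A' B'" and fin: "finite A" "finite B" "finite A'" "finite B'"
    and disj: "A \<inter> B = {}" and le: "card A \<le> card A'" "card B \<le> card B'"
  shows "contains G (split_graph c two A B)"
proof -
  obtain g h where g: "inj_on g A" "g ` A \<subseteq> A'" and h: "inj_on h B" "h ` B \<subseteq> B'"
    using card_le_inj fin le by metis
  define f where "f x = (if x \<in> A then g x else h x)" for x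
  have disj': "A' \<inter> B' = {}" and sub': "A' \<union> B' \<subseteq> verts G"
    using G by (auto simp: split_in_def)
  have fA: "f x \<in> A'" if "x \<in> A" for x
    using that g by (auto simp: f_def)
  have fB: "f x \<in> B'" if "x \<in> B" for x
    using that h disj by (auto simp: f_def)
  have inj: "inj_on f (A \<union> B)"
  proof (rule inj_onI)
    fix x y assume xy: "x \<in> A \<union> B" "y \<in> A \<union> B" "f x = f y"
    then have "x \<in> A \<longleftrightarrow> y \<in> A"
      using fA fB disj' by (metis Un_iff disjoint_iff)
    with xy g h disj show "x = y"
      by (auto simp: f_def dest: inj_onD split: if_splits)
  qed
  have img: "f ` e \<subseteq> A' \<longleftrightarrow> e \<subseteq> A" "f ` e \<subseteq> B' \<longleftrightarrow> e \<subseteq> B" "f ` e \<subseteq> A' \<union> B'"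
    if "e \<subseteq> A \<union> B" for e
    using that fA fB disj disj' by blast+
  have *: "f ` e \<in> clique_pairs two A' B' \<longleftrightarrow> e \<in> clique_pairs two A B" "f ` e \<in> pairs (A' \<union> B')"
    if "e \<in> pairs (A \<union> B)" for e
    using that img[of e] image_in_pairs_iff[OF inj, of e]
    by (auto simp: clique_pairs_def pairs_def)
  have cl: "f ` e \<in> colour_class G d" if "e \<in> colour_class (split_graph c two A B) d" for e d
  proof (cases "d = c")
    case True
    with that have "e \<in> clique_pairs two A B"
      by simp
    then have "f ` e \<in> clique_pairs two A' B'"
      using *(1) clique_pairs_subset by blast
    with G True show ?thesis
      unfolding split_in_def by blast
  next
    case False
    with that *[of e] G show ?thesis
      by (auto simp: split_in_def neq_iff_eq_opp)
  qed
  have "f ` (A \<union> B) \<subseteq> verts G"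
    using fA fB sub' by auto
  with inj cl show ?thesis
    unfolding contains_def by (intro exI[of _ f]) auto
qed

subsection \<open>Sampling vertices\<close>

lemma card_subsets_containing:
  assumes "finite V" "T \<subseteq> V" "card T \<le> m"
  shows "card {S. S \<subseteq> V \<and> card S = m \<and> T \<subseteq> S} = (card V - card T) choose (m - card T)"
proof -
  have fT: "finite T"
    using assms finite_subset by blast
  have "{S. S \<subseteq> V \<and> card S = m \<and> T \<subseteq> S} = (\<union>) T ` {U. U \<subseteq> V - T \<and> card U = m - card T}"
    (is "?L = _ ` ?R")
  proof (intro equalityI subsetI)
    fix S assume S: "S \<in> ?L"
    then have "S = T \<union> (S - T)" "S - T \<in> ?R"
      using fT by (auto simp: card_Diff_subset)
    then show "S \<in> (\<union>) T ` ?R"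
      by blast
  next
    fix S assume "S \<in> (\<union>) T ` ?R"
    then obtain U where U: "S = T \<union> U" "U \<subseteq> V - T" "card U = m - card T"
      by auto
    moreover have "finite U"
      using U assms finite_subset by blast
    moreover have "T \<inter> U = {}"
      using U by blast
    ultimately show "S \<in> ?L"
      using assms fT by (auto simp: card_Un_disjoint)
  qed
  moreover have "inj_on ((\<union>) T) ?R"
    by (rule inj_onI) blast
  ultimately have "card ?L = card ?R"
    by (simp add: card_image)
  also have "\<dots> = (card V - card T) choose (m - card T)"
    using assms fT n_subsets[of "V - T"] by (simp add: card_Diff_subset)
  finally show ?thesis .
qed

text \<open>The factor \<open>m / n\<close> is the probability that a random \<open>m\<close>-subset
  of an \<open>n\<close>-set contains a given point. Applying this twice handles pairs.\<close>

lemma binomial_pred: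
  assumes "1 \<le> m" "m \<le> n"
  shows "real ((n - 1) choose (m - 1)) = real (n choose m) * (real m / real n)"
proof -
  have "m * (n choose m) = n * ((n - 1) choose (m - 1))"
    using assms by (intro times_binomial_minus1_eq) auto
  then have "real m * real (n choose m) = real n * real ((n - 1) choose (m - 1))"
    by (metis of_nat_mult)
  with assms show ?thesis
    by (simp add: field_simps)
qed

lemma diff_ratio_le:
  fixes a b x :: real
  assumes "0 \<le> x" "x < b" "a \<le> b"
  shows "(a - x) / (b - x) \<le> a / b"
proof -
  have "x * a \<le> x * b"
    using assms by (intro mult_left_mono)
  with assms show ?thesis
    by (simp add: field_simps)
qed

text \<open>
  The probability that a given pair lies in a random \<open>m\<close>-subset of an \<open>n\<close>-set.
\<close>

definition pair_prob :: "nat \<Rightarrow> nat \<Rightarrow> real" where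
  "pair_prob m n = (real m / real n) * ((real m - 1) / (real n - 1))"

lemma double_choose_two: "2 * (n choose 2) = n * (n - 1)"
  using times_binomial_minus1_eq[of 2 n] by simp

lemma choose_two_real: "real (n choose 2) = real n * (real n - 1) / 2"
proof (cases n)
  case (Suc k)
  have "2 * real (n choose 2) = real n * real (n - 1)"
    using double_choose_two by (metis of_nat_mult of_nat_numeral)
  with Suc show ?thesis
    by simp
qed simp

lemma pair_prob_eq: "pair_prob m n = real (m choose 2) / real (n choose 2)"
  unfolding pair_prob_def choose_two_real by simp

lemma choose_sub_two:
  assumes "2 \<le> m" "m \<le> n"
  shows "real ((n - 2) choose (m - 2)) = real (n choose m) * pair_prob m n"
proof -
  have "real ((n - 1 - 1) choose (m - 1 - 1)) = real ((n - 1) choose (m - 1)) * (real (m - 1) / real (n - 1))"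
    using assms by (intro binomial_pred) auto
  also have "real ((n - 1) choose (m - 1)) = real (n choose m) * (real m / real n)"
    using assms by (intro binomial_pred) auto
  finally show ?thesis
    using assms by (simp add: pair_prob_def of_nat_diff numeral_2_eq_2)
qed

text \<open>This is the negative correlation of two disjoint pairs. Once one pair is in the sample,
  the rest is a random subset of size \<open>m - 2\<close> of the other \<open>n - 2\<close> points,
  and \<open>pair_prob (m - 2) (n - 2)\<close> is at most \<open>pair_prob m n\<close>.\<close>

lemma choose_sub_four:
  assumes "4 \<le> m" "m \<le> n"
  shows "real ((n - 4) choose (m - 4)) \<le> real (n choose m) * (pair_prob m n)\<^sup>2"
proof -
  have "pair_prob (m - 2) (n - 2) =
      ((real m - 2) / (real n - 2)) * ((real m - 1 - 2) / (real n - 1 - 2))"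
    using assms by (simp add: pair_prob_def of_nat_diff)
  also have "\<dots> \<le> pair_prob m n"
    unfolding pair_prob_def using assms by (intro mult_mono diff_ratio_le) auto
  finally have mono: "pair_prob (m - 2) (n - 2) \<le> pair_prob m n" .
  have "real ((n - 2 - 2) choose (m - 2 - 2)) =
      real ((n - 2) choose (m - 2)) * pair_prob (m - 2) (n - 2)"
    using assms by (intro choose_sub_two) auto
  also have "real ((n - 2) choose (m - 2)) = real (n choose m) * pair_prob m n"
    using assms by (intro choose_sub_two) auto
  also have "\<dots> * pair_prob (m - 2) (n - 2) \<le> \<dots> * pair_prob m n"
    using mono by (intro mult_left_mono) (auto simp: pair_prob_eq)
  finally show ?thesis
    by (simp add: power2_eq_square mult.assoc)
qed

text \<open>Double counting of edges and the samples around them. Probabilistic statements appear as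
  sums over all \<open>m\<close>-subsets, normalised by \<open>card V choose m\<close>; this one is
  the expectation.\<close>

lemma sum_card_pairs_inter:
  assumes V: "finite V" and E: "E \<subseteq> pairs V" and m: "2 \<le> m" "m \<le> card V"
  shows "(\<Sum>S\<in>{S. S \<subseteq> V \<and> card S = m}. real (card (E \<inter> pairs S))) =
    real (card V choose m) * (real (card E) * pair_prob m (card V))"
proof -
  let ?F = "{S. S \<subseteq> V \<and> card S = m}"
  have fin: "finite ?F" "finite E"
    using V E finite_pairs finite_subset by auto
  have "(\<Sum>S\<in>?F. card (E \<inter> pairs S)) = (\<Sum>S\<in>?F. card {e \<in> E. e \<subseteq> S})"
    using E by (intro sum.cong arg_cong[of _ _ card]) (auto simp: pairs_def)
  also have "\<dots> = (\<Sum>e\<in>E. card {S \<in> ?F. e \<subseteq> S})"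
    using fin by (intro sum_multicount_gen) auto
  also have "\<dots> = (\<Sum>e\<in>E. (card V - 2) choose (m - 2))"
  proof (rule sum.cong)
    fix e assume "e \<in> E"
    with E have "e \<subseteq> V" "card e = 2"
      by (auto simp: pairs_def)
    with card_subsets_containing[OF V, of e m] m
    show "card {S \<in> ?F. e \<subseteq> S} = (card V - 2) choose (m - 2)"
      by (simp add: conj_assoc)
  qed simp
  also have "\<dots> = card E * ((card V - 2) choose (m - 2))"
    by simp
  finally have "(\<Sum>S\<in>?F. real (card (E \<inter> pairs S))) = real (card E) * real ((card V - 2) choose (m - 2))"
    by (metis (no_types, lifting) of_nat_mult of_nat_sum sum.cong)
  then show ?thesis
    using m by (simp add: choose_sub_two)
qed

text \<open>Two meeting pairs have the form {x, y} and {x, z}, with y = z if they coincide, so a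
  triple of points determines them.\<close>

lemma card_meeting_pairs_le:
  assumes "finite S"
  shows "card {(e, f). e \<in> pairs S \<and> f \<in> pairs S \<and> e \<inter> f \<noteq> {}} \<le> card S ^ 3"
proof -
  have "{(e, f). e \<in> pairs S \<and> f \<in> pairs S \<and> e \<inter> f \<noteq> {}} \<subseteq>
      (\<lambda>(x, y, z). ({x, y}, {x, z})) ` (S \<times> S \<times> S)"
  proof clarify
    fix e f assume ef: "e \<in> pairs S" "f \<in> pairs S" "e \<inter> f \<noteq> {}"
    then obtain x where x: "x \<in> e" "x \<in> f"
      by blast
    from ef(1) x(1) obtain y where "e = {x, y}" "x \<in> S" "y \<in> S"
      by (elim pairsE) auto
    moreover from ef(2) x(2) obtain z where "f = {x, z}" "z \<in> S"
      by (elim pairsE) auto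
    ultimately show "(e, f) \<in> (\<lambda>(x, y, z). ({x, y}, {x, z})) ` (S \<times> S \<times> S)"
      by (intro image_eqI[of _ _ "(x, y, z)"]) auto
  qed
  then have "card {(e, f). e \<in> pairs S \<and> f \<in> pairs S \<and> e \<inter> f \<noteq> {}} \<le> card (S \<times> S \<times> S)"
    using assms by (intro surj_card_le) auto
  also have "\<dots> = card S ^ 3"
    by (simp add: card_cartesian_product power3_eq_cube)
  finally show ?thesis .
qed

text \<open>
  Disjoint pairs are negatively correlated, so only the at most \<open>m\<^sup>3\<close> ordered couples of
  intersecting pairs inside a sample contribute to the variance.
\<close>

lemma variance_pairs_inter:
  assumes V: "finite V" and E: "E \<subseteq> pairs V" and m: "4 \<le> m" "m \<le> card V"
  shows "(\<Sum>S\<in>{S. S \<subseteq> V \<and> card S = m}.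
      (real (card (E \<inter> pairs S)) - real (card E) * pair_prob m (card V))\<^sup>2)
    \<le> real (card V choose m) * real m ^ 3"
proof -
  let ?F = "{S. S \<subseteq> V \<and> card S = m}"
  define \<mu> where "\<mu> = real (card E) * pair_prob m (card V)"
  define N where "N = real (card V choose m)"
  define D where "D = {(e, f). e \<in> E \<and> f \<in> E \<and> e \<inter> f = {}}"
  have fin: "finite ?F" "finite E"
    using V E finite_pairs finite_subset by auto
  have DE: "D \<subseteq> E \<times> E"
    by (auto simp: D_def)
  then have fD: "finite D"
    using fin finite_subset by blast
  have cF: "real (card ?F) = N"
    using V n_subsets[of V m] by (simp add: N_def)
  have sq: "card (E \<inter> pairs S) ^ 2 \<le> card {p \<in> D. fst p \<union> snd p \<subseteq> S} + m ^ 3"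
    if S: "S \<in> ?F" for S
  proof -
    have fS: "finite S"
      using S V finite_subset by blast
    have "card (E \<inter> pairs S) ^ 2 = card ((E \<inter> pairs S) \<times> (E \<inter> pairs S))"
      by (simp add: card_cartesian_product power2_eq_square)
    also have "\<dots> \<le> card ({p \<in> D. fst p \<union> snd p \<subseteq> S} \<union>
        {(e, f). e \<in> pairs S \<and> f \<in> pairs S \<and> e \<inter> f \<noteq> {}})"
    proof (rule card_mono)
      have "{(e, f). e \<in> pairs S \<and> f \<in> pairs S \<and> e \<inter> f \<noteq> {}} \<subseteq> pairs S \<times> pairs S"
        by auto
      then show "finite ({p \<in> D. fst p \<union> snd p \<subseteq> S} \<union>
        {(e, f). e \<in> pairs S \<and> f \<in> pairs S \<and> e \<inter> f \<noteq> {}})"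
        using fD finite_subset[OF _ finite_cartesian_product[OF finite_pairs finite_pairs], OF _ fS fS]
        by auto
      show "(E \<inter> pairs S) \<times> (E \<inter> pairs S) \<subseteq> {p \<in> D. fst p \<union> snd p \<subseteq> S} \<union>
        {(e, f). e \<in> pairs S \<and> f \<in> pairs S \<and> e \<inter> f \<noteq> {}}"
        by (auto simp: D_def pairs_def)
    qed
    also have "\<dots> \<le> card {p \<in> D. fst p \<union> snd p \<subseteq> S} +
        card {(e, f). e \<in> pairs S \<and> f \<in> pairs S \<and> e \<inter> f \<noteq> {}}"
      by (rule card_Un_le)
    also have "\<dots> \<le> card {p \<in> D. fst p \<union> snd p \<subseteq> S} + m ^ 3"
      using card_meeting_pairs_le[OF fS] S by simp
    finally show ?thesis .
  qed
  have "(\<Sum>S\<in>?F. card {p \<in> D. fst p \<union> snd p \<subseteq> S}) =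
      (\<Sum>p\<in>D. card {S \<in> ?F. fst p \<union> snd p \<subseteq> S})"
    using fin(1) fD by (intro sum_multicount_gen) auto
  also have "\<dots> = (\<Sum>p\<in>D. (card V - 4) choose (m - 4))"
  proof (rule sum.cong)
    fix p assume "p \<in> D"
    then obtain e f where p: "p = (e, f)" "e \<in> E" "f \<in> E" "e \<inter> f = {}"
      by (auto simp: D_def)
    with E have ef: "e \<subseteq> V" "card e = 2" "f \<subseteq> V" "card f = 2"
      by (auto simp: pairs_def)
    then have "card (e \<union> f) = 4"
      using p V finite_subset by (subst card_Un_disjoint) auto
    with card_subsets_containing[OF V, of "e \<union> f" m] m ef p
    show "card {S \<in> ?F. fst p \<union> snd p \<subseteq> S} = (card V - 4) choose (m - 4)"
      by (simp add: conj_assoc)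
  qed simp
  also have "\<dots> = card D * ((card V - 4) choose (m - 4))"
    by simp
  finally have "(\<Sum>S\<in>?F. real (card {p \<in> D. fst p \<union> snd p \<subseteq> S})) =
      real (card D) * real ((card V - 4) choose (m - 4))"
    by (metis (no_types, lifting) of_nat_mult of_nat_sum sum.cong)
  also have "\<dots> \<le> (real (card E))\<^sup>2 * (N * (pair_prob m (card V))\<^sup>2)"
  proof (rule mult_mono)
    have "card D \<le> card (E \<times> E)"
      using DE fin by (intro card_mono) auto
    then show "real (card D) \<le> (real (card E))\<^sup>2"
      by (simp add: card_cartesian_product power2_eq_square flip: of_nat_mult)
    show "real ((card V - 4) choose (m - 4)) \<le> N * (pair_prob m (card V))\<^sup>2"
      unfolding N_def using m by (rule choose_sub_four)
  qed auto
  also have "\<dots> = N * \<mu>\<^sup>2"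
    by (simp add: \<mu>_def power_mult_distrib mult_ac)
  finally have disj: "(\<Sum>S\<in>?F. real (card {p \<in> D. fst p \<union> snd p \<subseteq> S})) \<le> N * \<mu>\<^sup>2" .
  have "(\<Sum>S\<in>?F. (real (card (E \<inter> pairs S)))\<^sup>2) \<le>
      (\<Sum>S\<in>?F. real (card {p \<in> D. fst p \<union> snd p \<subseteq> S}) + real m ^ 3)"
  proof (rule sum_mono)
    fix S assume "S \<in> ?F"
    from of_nat_mono[OF sq[OF this], where 'a = real]
    show "(real (card (E \<inter> pairs S)))\<^sup>2 \<le> real (card {p \<in> D. fst p \<union> snd p \<subseteq> S}) + real m ^ 3"
      by simp
  qed
  also have "\<dots> \<le> N * \<mu>\<^sup>2 + N * real m ^ 3"
    using disj by (simp add: sum.distrib cF)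
  finally have second: "(\<Sum>S\<in>?F. (real (card (E \<inter> pairs S)))\<^sup>2) \<le> N * \<mu>\<^sup>2 + N * real m ^ 3" .
  have first: "(\<Sum>S\<in>?F. real (card (E \<inter> pairs S))) = N * \<mu>"
    using sum_card_pairs_inter[OF V E, of m] m by (simp add: N_def \<mu>_def)
  have "(\<Sum>S\<in>?F. (real (card (E \<inter> pairs S)) - \<mu>)\<^sup>2) =
      (\<Sum>S\<in>?F. (real (card (E \<inter> pairs S)))\<^sup>2 + \<mu>\<^sup>2 - (2 * \<mu>) * real (card (E \<inter> pairs S)))"
    by (intro sum.cong) (auto simp: power2_diff)
  also have "\<dots> = (\<Sum>S\<in>?F. (real (card (E \<inter> pairs S)))\<^sup>2) + N * \<mu>\<^sup>2 -
      (2 * \<mu>) * (\<Sum>S\<in>?F. real (card (E \<inter> pairs S)))"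
    by (simp only: sum_subtractf sum.distrib sum_distrib_left[symmetric] sum_constant cF)
  also have "\<dots> \<le> N * real m ^ 3"
    using second unfolding first by (simp add: power2_eq_square)
  finally show ?thesis
    by (simp add: \<mu>_def N_def)
qed

text \<open>Each of the two squared deviations averages at most \<open>m ^ 3\<close>. Every pair of
  \<open>M\<close> inside the sample is charged \<open>3 * m ^ 3\<close>, so by the last hypothesis
  the average charge is below \<open>m ^ 3\<close>. Hence some sample has a total below
  \<open>3 * m ^ 3\<close>, and there a single pair of \<open>M\<close> would already cost too much.
  \<open>M\<close> will be the set of non-edges when the sample has to be complete.\<close>

lemma sampling:
  assumes V: "finite V" and m: "4 \<le> m" "m \<le> card V"
    and sub: "R \<subseteq> pairs V" "B \<subseteq> pairs V" "M \<subseteq> pairs V"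
    and M: "3 * real (card M) * pair_prob m (card V) < 1"
  obtains S where "S \<subseteq> V" "card S = m" "M \<inter> pairs S = {}"
    "(real (card (R \<inter> pairs S)) - real (card R) * pair_prob m (card V))\<^sup>2 \<le> 3 * real m ^ 3"
    "(real (card (B \<inter> pairs S)) - real (card B) * pair_prob m (card V))\<^sup>2 \<le> 3 * real m ^ 3"
proof -
  let ?F = "{S. S \<subseteq> V \<and> card S = m}"
  let ?v = "\<lambda>E S. (real (card (E \<inter> pairs S)) - real (card E) * pair_prob m (card V))\<^sup>2"
  define N where "N = real (card V choose m)"
  have N: "N > 0"
    using m by (simp add: N_def)
  have cF: "real (card ?F) = N"
    using V n_subsets[of V m] by (simp add: N_def)
  have m3: "real m ^ 3 > 0"
    using m by simp
  have "\<exists>S\<in>?F. ?v R S + ?v B S + 3 * real m ^ 3 * real (card (M \<inter> pairs S)) < 3 * real m ^ 3"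
  proof (rule ccontr)
    assume *: "\<not> ?thesis"
    have "N * (3 * real m ^ 3) = (\<Sum>S\<in>?F. 3 * real m ^ 3)"
      by (simp add: cF)
    also have "\<dots> \<le> (\<Sum>S\<in>?F. ?v R S + ?v B S + 3 * real m ^ 3 * real (card (M \<inter> pairs S)))"
      using * by (intro sum_mono) (auto simp: not_less)
    also have "\<dots> = (\<Sum>S\<in>?F. ?v R S) + (\<Sum>S\<in>?F. ?v B S) +
        3 * real m ^ 3 * (\<Sum>S\<in>?F. real (card (M \<inter> pairs S)))"
      by (simp only: sum.distrib sum_distrib_left)
    also have "(\<Sum>S\<in>?F. real (card (M \<inter> pairs S))) = N * (real (card M) * pair_prob m (card V))"
      using sum_card_pairs_inter[OF V sub(3), of m] m by (simp add: N_def)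
    also have "(\<Sum>S\<in>?F. ?v R S) + (\<Sum>S\<in>?F. ?v B S) +
        3 * real m ^ 3 * (N * (real (card M) * pair_prob m (card V))) \<le>
        N * real m ^ 3 + N * real m ^ 3 + (N * real m ^ 3) * (3 * real (card M) * pair_prob m (card V))"
      using variance_pairs_inter[OF V sub(1) m] variance_pairs_inter[OF V sub(2) m]
      by (simp add: N_def mult_ac)
    also have "\<dots> < N * real m ^ 3 + N * real m ^ 3 + (N * real m ^ 3) * 1"
      using N m3 M by (intro add_strict_left_mono mult_strict_left_mono) auto
    finally show False
      by simp
  qed
  then obtain S where S: "S \<subseteq> V" "card S = m"
    "?v R S + ?v B S + 3 * real m ^ 3 * real (card (M \<inter> pairs S)) < 3 * real m ^ 3"
    by auto
  have nn: "?v R S \<ge> 0" "?v B S \<ge> 0" "3 * real m ^ 3 * real (card (M \<inter> pairs S)) \<ge> 0"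
    by auto
  have "3 * real m ^ 3 * real (card (M \<inter> pairs S)) < 3 * real m ^ 3 * 1"
    using S(3) nn by linarith
  then have "real (card (M \<inter> pairs S)) < 1"
    using m3 by (subst (asm) mult_less_cancel_left_pos) auto
  moreover have "finite (M \<inter> pairs S)"
    using sub V finite_pairs finite_subset by blast
  ultimately have "M \<inter> pairs S = {}"
    by simp
  moreover have "?v R S \<le> 3 * real m ^ 3" "?v B S \<le> 3 * real m ^ 3"
    using S(3) nn by linarith+
  ultimately show ?thesis
    using S that by blast
qed

subsection \<open>Existence of the limit density\<close>

text \<open>
  Keeping the smaller colour class and trimming the larger one loses little; for \<open>\<epsilon> = 1 / 2\<close> the
  two classes have to be of exactly equal size, so one cannot simply scale both and round.
\<close>

lemma rebalance:
  assumes G: "bicolored G" and \<epsilon>: "0 < \<epsilon>" "\<epsilon> \<le> 1 / 2"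
  obtains H :: "'a bigraph" and c where "verts H = verts G" "bicolored H" "balanced \<epsilon> H"
    "\<And>d. colour_class H d \<subseteq> colour_class G d"
    "min (real (card (edges G))) (real (card (colour_class G c)) / \<epsilon> - 1) \<le> real (card (edges H))"
proof -
  obtain c where c: "card (colour_class G c) \<le> card (colour_class G (opp c))"
    by (metis nat_le_linear opp_opp)
  define a b where "a = card (colour_class G c)" and "b = card (colour_class G (opp c))"
  \<comment> \<open>With \<open>a\<close> edges in the smaller class, \<open>k\<close> edges in the
    other are allowed iff \<epsilon> * (a + k) \<le> a, that is, k \<le> (1 - \<epsilon>) /
    \<epsilon> * a.\<close>
  define k where "k = min b (nat \<lfloor>(1 - \<epsilon>) / \<epsilon> * real a\<rfloor>)"
  obtain K where K: "K \<subseteq> colour_class G (opp c)" "card K = k"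
    using obtain_subset_with_card_n[of k "colour_class G (opp c)"] by (auto simp: k_def b_def)
  define H where "H = \<lparr>verts = verts G, colour_class = (\<lambda>d. if d = c then colour_class G c else K)\<rparr>"
  have H: "verts H = verts G" "colour_class H c = colour_class G c" "colour_class H (opp c) = K"
    by (auto simp: H_def)
  have sub: "colour_class H d \<subseteq> colour_class G d" for d
    using K H by (cases "d = c") (auto simp: neq_iff_eq_opp)
  have "edges H \<subseteq> pairs (verts H)"
    using sub bicoloredD(2)[OF G] H(1) by (auto simp: edges_def)
  then have bH: "bicolored H"
    using bicolored_class_sub[OF G] sub H(1) bicoloredD(1)[OF G] by auto
  have eH: "card (edges H) = a + k"
    using bicoloredD(5)[OF bH, of c] H K by (simp add: a_def)
  have eG: "card (edges G) = a + b"
    using bicoloredD(5)[OF G, of c] by (simp add: a_def b_def)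
  \<comment> \<open>Here \<epsilon> \<le> 1/2 enters: trimming never makes the larger class smaller
    than \<open>a\<close>, so it keeps at least half of the edges and its own balance condition
    holds.\<close>
  have one: "1 \<le> (1 - \<epsilon>) / \<epsilon>"
    using \<epsilon> by (simp add: field_simps)
  have "real a \<le> (1 - \<epsilon>) / \<epsilon> * real a"
    using mult_right_mono[OF one, of "real a"] by simp
  then have ak: "a \<le> k"
    using c by (simp add: k_def a_def b_def le_nat_floor)
  have "0 \<le> (1 - \<epsilon>) / \<epsilon> * real a"
    using one by (intro mult_nonneg_nonneg) auto
  then have "real k \<le> (1 - \<epsilon>) / \<epsilon> * real a"
    unfolding k_def by linarith
  then have "\<epsilon> * real k \<le> (1 - \<epsilon>) * real a"
    using \<epsilon> by (simp add: field_simps)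
  then have "\<epsilon> * real (a + k) \<le> real a"
    by (simp add: algebra_simps)
  moreover have "\<epsilon> * real (a + k) \<le> (1 / 2) * real (k + k)"
    using ak \<epsilon> by (intro mult_mono) auto
  ultimately have "\<epsilon> * real (card (edges H)) \<le> real (card (colour_class H d))" for d
    unfolding eH using H K by (cases "d = c") (auto simp: neq_iff_eq_opp a_def)
  then have "balanced \<epsilon> H"
    by (simp add: balanced_def)
  moreover have "min (real (card (edges G))) (real a / \<epsilon> - 1) \<le> real (card (edges H))"
  proof (cases "k = b")
    case False
    then have "k = nat \<lfloor>(1 - \<epsilon>) / \<epsilon> * real a\<rfloor>"
      by (simp add: k_def min_def split: if_splits)
    \<comment> \<open>The trimmed graph has a + (1 - \<epsilon>) / \<epsilon> * a = a / \<epsilon>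
      edges, up to a rounding loss of 1.\<close>
    then have "(1 - \<epsilon>) / \<epsilon> * real a - 1 \<le> real k"
      by linarith
    then have "real a / \<epsilon> - 1 \<le> real (a + k)"
      using \<epsilon> by (simp add: field_simps)
    then show ?thesis
      by (simp add: eH)
  qed (simp add: eH eG)
  ultimately show ?thesis
    using that bH sub H(1) by (simp add: a_def)
qed

section \<open>Induced subgraphs on random samples\<close>

definition induced :: "'a bigraph \<Rightarrow> 'a set \<Rightarrow> 'a bigraph" where
  "induced G S = \<lparr>verts = S, colour_class = (\<lambda>c. colour_class G c \<inter> pairs S)\<rparr>"

lemma induced_simps [simp]:
  "verts (induced G S) = S"
  "colour_class (induced G S) c = colour_class G c \<inter> pairs S"
  "edges (induced G S) = edges G \<inter> pairs S"
  by (auto simp: induced_def edges_def)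

lemma bicolored_induced:
  assumes "bicolored G" "S \<subseteq> verts G"
  shows "bicolored (induced G S)"
  using assms finite_subset[of S "verts G"] by (auto simp: bicolored_def)

lemma sampling_induced:
  assumes G: "bicolored G" and m: "4 \<le> m" "m \<le> card (verts G)" and M: "M \<subseteq> pairs (verts G)"
    and small: "3 * real (card M) * pair_prob m (card (verts G)) < 1"
  obtains S where "S \<subseteq> verts G" "card S = m" "M \<inter> pairs S = {}"
    "\<And>c. real (card (colour_class G c)) * pair_prob m (card (verts G)) - sqrt (3 * real m ^ 3)
      \<le> real (card (colour_class (induced G S) c))"
proof -
  let ?v = "\<lambda>c S. real (card (colour_class G c \<inter> pairs S)) -
    real (card (colour_class G c)) * pair_prob m (card (verts G))"
  obtain S where S: "S \<subseteq> verts G" "card S = m" "M \<inter> pairs S = {}"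
    "(?v Red S)\<^sup>2 \<le> 3 * real m ^ 3" "(?v Blue S)\<^sup>2 \<le> 3 * real m ^ 3"
    using sampling[OF bicoloredD(1)[OF G] m bicoloredD(2)[OF G] bicoloredD(2)[OF G] M small] .
  have "real (card (colour_class G c)) * pair_prob m (card (verts G)) - sqrt (3 * real m ^ 3)
      \<le> real (card (colour_class (induced G S) c))" for c
  proof -
    have "(?v c S)\<^sup>2 \<le> 3 * real m ^ 3"
      using S by (cases c) auto
    then have "- ?v c S \<le> sqrt (3 * real m ^ 3)"
      by (intro real_le_rsqrt) (simp only: power2_minus)
    then show ?thesis
      by simp
  qed
  with S(1-3) show ?thesis
    using that by blast
qed

section \<open>Extremal graphs and their edge ratios\<close>

definition admissible :: "real \<Rightarrow> 'a bigraph set \<Rightarrow> 'b bigraph \<Rightarrow> bool" where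
  "admissible \<epsilon> \<F> G \<longleftrightarrow> bicolored G \<and> balanced \<epsilon> G \<and> (\<forall>F\<in>\<F>. \<not> contains G F)"

lemma ex_number_eq:
  "ex_number \<epsilon> n \<F> = Sup {card (edges G) | G :: nat bigraph. admissible \<epsilon> \<F> G \<and> card (verts G) = n}"
  unfolding ex_number_def admissible_def by (intro arg_cong[of _ _ Sup]) blast

lemma card_edges_le_ex_number:
  fixes G :: "nat bigraph"
  assumes "admissible \<epsilon> \<F> G" "card (verts G) = n"
  shows "card (edges G) \<le> ex_number \<epsilon> n \<F>"
  unfolding ex_number_eq
proof (rule cSup_upper)
  show "bdd_above {card (edges G) | G :: nat bigraph. admissible \<epsilon> \<F> G \<and> card (verts G) = n}"
    by (intro bdd_aboveI[of _ "n choose 2"]) (auto simp: admissible_def intro: card_edges_le)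
qed (use assms in blast)

text \<open>A nonzero value rules out the empty set of candidates, whose supremum in
  \<open>nat\<close> is 0.\<close>

lemma ex_number_attained:
  assumes "ex_number \<epsilon> n \<F> \<noteq> 0"
  obtains G :: "nat bigraph" where "admissible \<epsilon> \<F> G" "card (verts G) = n"
    "card (edges G) = ex_number \<epsilon> n \<F>"
proof -
  define X where "X = {card (edges G) | G :: nat bigraph. admissible \<epsilon> \<F> G \<and> card (verts G) = n}"
  have ex: "ex_number \<epsilon> n \<F> = Sup X"
    by (simp add: X_def ex_number_eq)
  have "X \<subseteq> {..n choose 2}"
    by (auto simp: X_def admissible_def intro: card_edges_le)
  then have fin: "finite X"
    using finite_subset by blast
  have ne: "X \<noteq> {}"
    using assms by (auto simp: ex)
  have "Sup X \<in> X"
    unfolding cSup_eq_Max[OF fin ne] using fin ne by (rule Max_in)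
  then obtain G :: "nat bigraph" where "admissible \<epsilon> \<F> G" "card (verts G) = n" "card (edges G) = Sup X"
    unfolding X_def by force
  then show ?thesis
    using that by (simp add: ex)
qed

lemma ex_number_le: "ex_number \<epsilon> n \<F> \<le> n choose 2"
proof (cases "ex_number \<epsilon> n \<F> = 0")
  case False
  then show ?thesis
    using ex_number_attained[OF False] card_edges_le unfolding admissible_def by metis
qed simp

definition ex_ratio :: "real \<Rightarrow> 'a bigraph set \<Rightarrow> nat \<Rightarrow> real" where
  "ex_ratio \<epsilon> \<F> n = real (ex_number \<epsilon> n \<F>) / real (n choose 2)"

lemma ex_ratio_bounds: "0 \<le> ex_ratio \<epsilon> \<F> n" "ex_ratio \<epsilon> \<F> n \<le> 1"
  using ex_number_le[of \<epsilon> n \<F>] by (auto simp: ex_ratio_def divide_le_eq)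

text \<open>Sample from an extremal graph on \<open>n\<close> vertices and rebalance. Each colour
  falls short of its expectation by at most \<open>D\<close>, so the sample loses at most
  \<open>2 * D\<close> edges. If rebalancing is limited by the smaller class, the loss of that class
  counts 1/\<epsilon> times and rounding costs one more edge. The error term covers both
  cases.\<close>

lemma ex_number_sampling:
  assumes \<epsilon>: "0 < \<epsilon>" "\<epsilon> \<le> 1 / 2" and m: "4 \<le> m" "m \<le> n"
  shows "real (ex_number \<epsilon> n \<F>) * pair_prob m n \<le>
    real (ex_number \<epsilon> m \<F>) + (2 * sqrt (3 * real m ^ 3) / \<epsilon> + 1)"
proof (cases "ex_number \<epsilon> n \<F> = 0")
  \<comment> \<open>There may be no graph to sample from, but then the left side is 0.\<close>
  case True
  then show ?thesis
    using \<epsilon> by simp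
next
  case False
  then obtain G :: "nat bigraph" where G: "admissible \<epsilon> \<F> G" "card (verts G) = n"
    "card (edges G) = ex_number \<epsilon> n \<F>"
    by (rule ex_number_attained)
  have bG: "bicolored G" and bal: "balanced \<epsilon> G"
    using G by (auto simp: admissible_def)
  define q where "q = pair_prob m n"
  define D where "D = sqrt (3 * real m ^ 3)"
  have q0: "0 \<le> q"
    by (simp add: q_def pair_prob_eq)
  have D0: "0 \<le> D"
    by (simp add: D_def)
  obtain S where S: "S \<subseteq> verts G" "card S = m"
    and cl': "\<And>d. real (card (colour_class G d)) * q - D \<le> real (card (colour_class (induced G S) d))"
    using sampling_induced[OF bG, of m "{}"] m G(2) unfolding q_def D_def by auto
  define I where "I = induced G S"
  have bI: "bicolored I"
    unfolding I_def using bG S(1) by (rule bicolored_induced)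
  note cl = cl'[folded I_def]
  obtain H c where H: "verts H = verts I" "bicolored H" "balanced \<epsilon> H"
    "\<And>d. colour_class H d \<subseteq> colour_class I d"
    "min (real (card (edges I))) (real (card (colour_class I c)) / \<epsilon> - 1) \<le> real (card (edges H))"
    using rebalance[OF bI \<epsilon>] by metis
  have "contains G H"
  proof (rule contains_subgraph)
    show "verts H \<subseteq> verts G"
      using H(1) S(1) by (simp add: I_def)
    show "colour_class H d \<subseteq> colour_class G d" for d
      using H(4)[of d] by (simp add: I_def)
  qed
  then have "admissible \<epsilon> \<F> H"
    using H G(1) contains_trans unfolding admissible_def by blast
  then have le: "card (edges H) \<le> ex_number \<epsilon> m \<F>"
    using H(1) S(2) by (intro card_edges_le_ex_number) (auto simp: I_def)
  have "D * 1 \<le> D * (1 / \<epsilon>)"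
    using \<epsilon> D0 by (intro mult_left_mono) auto
  then have D1: "D \<le> D / \<epsilon>"
    by simp
  have "real (card (edges G)) * q = real (card (colour_class G Red)) * q + real (card (colour_class G Blue)) * q"
    using bicoloredD(5)[OF bG, of Red] by (simp add: algebra_simps)
  then have 1: "real (card (edges G)) * q - 2 * D \<le> real (card (edges I))"
    using bicoloredD(5)[OF bI, of Red] cl[of Red] cl[of Blue] by simp
  have "\<epsilon> * real (card (edges G)) * q \<le> real (card (colour_class G c)) * q"
    using bal q0 by (intro mult_right_mono) (auto simp: balanced_def)
  then have "\<epsilon> * (real (card (edges G)) * q) - D \<le> real (card (colour_class I c))"
    using cl[of c] by simp
  then have "(\<epsilon> * (real (card (edges G)) * q) - D) / \<epsilon> \<le> real (card (colour_class I c)) / \<epsilon>"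
    using \<epsilon> by (intro divide_right_mono) auto
  then have 2: "real (card (edges G)) * q - D / \<epsilon> \<le> real (card (colour_class I c)) / \<epsilon>"
    using \<epsilon> by (simp add: diff_divide_distrib)
  have "real (card (edges G)) * q - (2 * D / \<epsilon> + 1) \<le> real (card (edges H))"
    using 1 2 D1 D0 H(5) by (auto simp: min_le_iff_disj)
  then show ?thesis
    using le G(3) by (simp add: q_def D_def)
qed

text \<open>The limit is the infimum \<open>c\<close> of \<open>x m + g m\<close> over
  \<open>m\<close> \<ge> \<open>k\<close>. Each of these values bounds all later terms of
  \<open>x\<close> from above, while \<open>x n\<close> is at least \<open>c - g n\<close> and
  \<open>g\<close> tends to 0.\<close>

lemma convergent_if_eventually_almost_decreasing:
  fixes x g :: "nat \<Rightarrow> real"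
  assumes x: "\<And>n. 0 \<le> x n" and g: "g \<longlonglongrightarrow> 0"
    and le: "\<And>m n. k \<le> m \<Longrightarrow> m \<le> n \<Longrightarrow> x n \<le> x m + g m"
  shows "convergent x"
proof -
  define c where "c = Inf ((\<lambda>m. x m + g m) ` {k..})"
  have nn: "0 \<le> x m + g m" if "k \<le> m" for m
    using x[of m] le[OF that order_refl] x[of m] by linarith
  have bdd: "bdd_below ((\<lambda>m. x m + g m) ` {k..})"
    using nn by (intro bdd_belowI[of _ 0]) auto
  have "x \<longlonglongrightarrow> c"
  proof (rule order_tendstoI)
    fix a assume "c < a"
    then obtain m where m: "k \<le> m" "x m + g m < a"
      using cInf_lessD[of "(\<lambda>m. x m + g m) ` {k..}" a] unfolding c_def by auto
    with le[OF m(1)] show "\<forall>\<^sub>F n in sequentially. x n < a"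
      by (intro eventually_sequentiallyI[of m]) (meson le_less_trans)
  next
    fix a assume "a < c"
    then have "\<forall>\<^sub>F n in sequentially. g n < c - a"
      using g by (intro order_tendstoD(2)) auto
    with eventually_ge_at_top[of k] show "\<forall>\<^sub>F n in sequentially. a < x n"
    proof eventually_elim
      fix n assume "k \<le> n" "g n < c - a"
      moreover have "c \<le> x n + g n"
        unfolding c_def using \<open>k \<le> n\<close> bdd by (intro cInf_lower) auto
      ultimately show "a < x n"
        by linarith
    qed
  qed
  then show ?thesis
    by (rule convergentI)
qed

text \<open>As \<open>pair_prob m n\<close> is a quotient of binomials, dividing
  \<open>ex_number_sampling\<close> by \<open>m choose 2\<close> turns its left side into the ratio
  at \<open>n\<close>. The error becomes of order m^(-1/2).\<close>

lemma convergent_ex_ratio: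
  assumes \<epsilon>: "0 < \<epsilon>" "\<epsilon> \<le> 1 / 2"
  shows "convergent (ex_ratio \<epsilon> \<F>)"
proof (rule convergent_if_eventually_almost_decreasing)
  let ?g = "\<lambda>m. (2 * sqrt (3 * real m ^ 3) / \<epsilon> + 1) / real (m choose 2)"
  show "?g \<longlonglongrightarrow> 0"
    unfolding choose_two_real using \<epsilon> by real_asymp
  show "ex_ratio \<epsilon> \<F> n \<le> ex_ratio \<epsilon> \<F> m + ?g m" if "4 \<le> m" "m \<le> n" for m n
  proof -
    have "0 < real (m choose 2)"
      using that by simp
    with ex_number_sampling[OF \<epsilon> that, of \<F>] show ?thesis
      unfolding ex_ratio_def pair_prob_eq
      by (simp add: add_divide_distrib[symmetric] pos_le_divide_eq)
  qed
qed (rule ex_ratio_bounds)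

lemma ex_ratio_tendsto:
  assumes "0 < \<epsilon>" "\<epsilon> \<le> 1 / 2"
  shows "ex_ratio \<epsilon> \<F> \<longlonglongrightarrow> ex_density \<epsilon> \<F>"
  using convergent_ex_ratio[OF assms, of \<F>]
  unfolding ex_density_def ex_ratio_def[abs_def] by (simp add: convergent_LIMSEQ_iff)

subsection \<open>Unavoidable patterns in balanced complete graphs\<close>

text \<open>Each point lies in a fraction \<open>a / card A\<close> of all \<open>a\<close>-subsets,
  so some subset reaches the average. This serves to replace one side of a dense bipartite graph by
  a set of constant size.\<close>

lemma exists_subset_above_average:
  fixes f :: "'a \<Rightarrow> real"
  assumes A: "finite A" and a: "1 \<le> a" "a \<le> card A"
  obtains A0 where "A0 \<subseteq> A" "card A0 = a" "real a * sum f A \<le> real (card A) * sum f A0"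
proof -
  let ?F = "{S. S \<subseteq> A \<and> card S = a}"
  have fin: "finite ?F"
    using A by simp
  have cF: "card ?F = card A choose a"
    using A by (rule n_subsets)
  have "(\<Sum>S\<in>?F. sum f S) = (\<Sum>S\<in>?F. \<Sum>x | x \<in> A \<and> x \<in> S. f x)"
    by (intro sum.cong) (auto intro: arg_cong[of _ _ "sum f"])
  also have "\<dots> = (\<Sum>x\<in>A. \<Sum>S | S \<in> ?F \<and> x \<in> S. f x)"
    using fin A by (rule sum.swap_restrict)
  also have "\<dots> = (\<Sum>x\<in>A. real ((card A - 1) choose (a - 1)) * f x)"
  proof (rule sum.cong)
    fix x assume "x \<in> A"
    with card_subsets_containing[OF A, of "{x}" a] a
    show "(\<Sum>S | S \<in> ?F \<and> x \<in> S. f x) = real ((card A - 1) choose (a - 1)) * f x"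
      by (simp add: conj_assoc)
  qed simp
  also have "\<dots> = real (card A choose a) * (real a / real (card A) * sum f A)"
    using a by (simp only: sum_distrib_left[symmetric] binomial_pred mult.assoc)
  finally have total: "(\<Sum>S\<in>?F. sum f S) = real (card A choose a) * (real a / real (card A) * sum f A)" .
  have "\<exists>S\<in>?F. real a / real (card A) * sum f A \<le> sum f S"
  proof (rule ccontr)
    assume "\<not> ?thesis"
    moreover have "?F \<noteq> {}"
      using cF a by (metis binomial_eq_0_iff card.empty not_less)
    ultimately have "(\<Sum>S\<in>?F. sum f S) < (\<Sum>S\<in>?F. real a / real (card A) * sum f A)"
      using fin by (intro sum_strict_mono) auto
    then show False
      by (simp add: total cF)
  qed
  then obtain S where "S \<subseteq> A" "card S = a" "real a / real (card A) * sum f A \<le> sum f S"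
    by auto
  moreover from this a have "real a * sum f A \<le> real (card A) * sum f S"
    by (simp add: field_simps)
  ultimately show ?thesis
    using that by blast
qed

text \<open>A form of the Kovari-Sos-Turan theorem. Restrict the left side to a set
  \<open>A0\<close> of constant size \<open>a\<close> that still sees density \<gamma>. Then at
  least \<open>\<gamma> * k / 2\<close> vertices on the right have \<open>t\<close> neighbours in
  \<open>A0\<close>, while there are only \<open>a choose t\<close> sets of \<open>t\<close>
  possible neighbours. For large \<open>k\<close>, one of these sets is shared by more than
  \<open>t\<close> vertices.\<close>

lemma dense_bipartite_contains_biclique:
  fixes \<gamma> :: real
  assumes \<gamma>: "0 < \<gamma>"
  shows "\<exists>k0. \<forall>k\<ge>k0. \<forall>(A :: 'a set) (B :: 'a set). \<forall>P. finite A \<and> finite B \<and> card A = k \<and> card B = k \<and>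
    \<gamma> * real k ^ 2 \<le> real (card {p \<in> A \<times> B. P (fst p) (snd p)}) \<longrightarrow>
    (\<exists>T U. T \<subseteq> A \<and> U \<subseteq> B \<and> card T = t \<and> card U = t \<and> (\<forall>x\<in>T. \<forall>y\<in>U. P x y))"
proof -
  \<comment> \<open>With 2 * t \<le> \<gamma> * a, right vertices with fewer than \<open>t\<close>
    neighbours in \<open>A0\<close> account for at most half of the edges at
    \<open>A0\<close>.\<close>
  define a where "a = nat \<lceil>2 * real t / \<gamma>\<rceil> + 1"
  define k0 where "k0 = max a (nat \<lceil>2 * real (t * (a choose t)) / \<gamma>\<rceil> + 1)"
  have "2 * real t / \<gamma> \<le> real a"
    unfolding a_def by linarith
  then have ta: "2 * real t \<le> \<gamma> * real a"
    using \<gamma> by (simp add: field_simps)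
  show ?thesis
  proof (intro exI[of _ k0] allI impI, elim conjE)
    fix k :: nat and A B :: "'a set" and P
    assume k: "k0 \<le> k" and AB: "finite A" "finite B" "card A = k" "card B = k"
      and E: "\<gamma> * real k ^ 2 \<le> real (card {p \<in> A \<times> B. P (fst p) (snd p)})"
    have "2 * real (t * (a choose t)) / \<gamma> < real k"
      using k unfolding k0_def by linarith
    then have kt: "2 * real (t * (a choose t)) < \<gamma> * real k"
      using \<gamma> by (simp add: field_simps)
    have ak: "1 \<le> a" "a \<le> k"
      using k by (auto simp: a_def k0_def)
    define f where "f x = real (card {y \<in> B. P x y})" for x
    obtain A0 where A0: "A0 \<subseteq> A" "card A0 = a" "real a * sum f A \<le> real k * sum f A0"
      using exists_subset_above_average[of A a f] AB ak by auto
    have fA0: "finite A0"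
      using A0 AB finite_subset by blast
    have "{p \<in> A \<times> B. P (fst p) (snd p)} = (SIGMA x:A. {y \<in> B. P x y})"
      by auto
    then have "real (card {p \<in> A \<times> B. P (fst p) (snd p)}) = sum f A"
      using AB by (simp add: f_def)
    then have "real a * (\<gamma> * real k ^ 2) \<le> real k * sum f A0"
      using A0(3) E by (metis mult_left_mono of_nat_0_le_iff order_trans)
    then have dense: "\<gamma> * real a * real k \<le> sum f A0"
      using ak by (simp add: power2_eq_square mult_ac)
    define d where "d y = card {x \<in> A0. P x y}" for y
    define B' where "B' = {y \<in> B. t \<le> d y}"
    have dle: "d y \<le> (if y \<in> B' then a else 0) + t" if "y \<in> B" for y
      using that card_mono[OF fA0, of "{x \<in> A0. P x y}"] A0(2) by (auto simp: d_def B'_def)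
    have "(\<Sum>x\<in>A0. card {y \<in> B. P x y}) = (\<Sum>y\<in>B. d y)"
      using fA0 AB by (intro sum_multicount_gen) (auto simp: d_def)
    also have "\<dots> \<le> (\<Sum>y\<in>B. (if y \<in> B' then a else 0) + t)"
      using dle by (rule sum_mono)
    also have "\<dots> = a * card B' + t * k"
      using AB by (simp add: sum.distrib sum.If_cases B'_def Int_def mult_ac)
    finally have "sum f A0 \<le> real (a * card B' + t * k)"
      unfolding f_def by (metis of_nat_mono of_nat_sum)
    moreover have "real t * real k \<le> (\<gamma> * real a / 2) * real k"
      using ta by (intro mult_right_mono) auto
    ultimately have "real a * (\<gamma> * real k / 2) \<le> real a * real (card B')"
      using dense by (simp add: mult_ac)
    then have B'_large: "\<gamma> * real k / 2 \<le> real (card B')"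
      using ak by simp
    show "\<exists>T U. T \<subseteq> A \<and> U \<subseteq> B \<and> card T = t \<and> card U = t \<and> (\<forall>x\<in>T. \<forall>y\<in>U. P x y)"
    proof (rule ccontr)
      assume none: "\<not> ?thesis"
      define C where "C T = {y \<in> B. \<forall>x\<in>T. P x y}" for T
      have C: "card (C T) \<le> t" if T: "T \<in> {T. T \<subseteq> A0 \<and> card T = t}" for T
      proof (rule ccontr)
        assume "\<not> card (C T) \<le> t"
        then obtain U where "U \<subseteq> C T" "card U = t"
          by (meson nat_le_linear obtain_subset_with_card_n)
        with T A0(1) have "T \<subseteq> A \<and> U \<subseteq> B \<and> card T = t \<and> card U = t \<and> (\<forall>x\<in>T. \<forall>y\<in>U. P x y)"
          unfolding C_def by blast
        with none show False
          by blast
      qed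
      have "B' \<subseteq> (\<Union>T\<in>{T. T \<subseteq> A0 \<and> card T = t}. C T)"
      proof
        fix y assume y: "y \<in> B'"
        then obtain T where "T \<subseteq> {x \<in> A0. P x y}" "card T = t"
          unfolding B'_def d_def by (auto elim: obtain_subset_with_card_n)
        with y show "y \<in> (\<Union>T\<in>{T. T \<subseteq> A0 \<and> card T = t}. C T)"
          by (auto simp: C_def B'_def)
      qed
      then have "card B' \<le> card (\<Union>T\<in>{T. T \<subseteq> A0 \<and> card T = t}. C T)"
        using fA0 AB by (intro card_mono) (auto simp: C_def)
      also have "\<dots> \<le> (\<Sum>T\<in>{T. T \<subseteq> A0 \<and> card T = t}. card (C T))"
        using fA0 by (intro card_UN_le) auto
      also have "\<dots> \<le> (\<Sum>T\<in>{T. T \<subseteq> A0 \<and> card T = t}. t)"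
        using C by (rule sum_mono)
      also have "\<dots> = t * (a choose t)"
        using n_subsets[OF fA0, of t] A0(2) by simp
      finally have "real (card B') \<le> real (t * (a choose t))"
        by (rule of_nat_mono)
      with B'_large kt show False
        by linarith
    qed
  qed
qed

section \<open>From monochromatic cliques to split patterns\<close>

lemma complete_classE:
  assumes "complete_graph G" "x \<in> verts G" "y \<in> verts G" "x \<noteq> y"
  shows "{x, y} \<in> colour_class G c \<or> {x, y} \<in> colour_class G (opp c)"
proof -
  have "{x, y} \<in> edges G"
    using assms by (auto simp: complete_graph_def pairs_def)
  then show ?thesis
    by (simp add: edges_eq[of G c])
qed

lemma split_inI:
  assumes "A \<subseteq> verts G" "B \<subseteq> verts G" "A \<inter> B = {}"
    and "pairs A \<subseteq> colour_class G c" "pairs B \<subseteq> colour_class G (if two then c else opp c)"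
    and cross: "\<And>x y. x \<in> A \<Longrightarrow> y \<in> B \<Longrightarrow> {x, y} \<in> colour_class G (opp c)"
  shows "split_in G c two A B"
proof -
  have "e \<in> colour_class G (opp c)" if e: "e \<in> pairs (A \<union> B) - clique_pairs two A B" for e
  proof -
    from e obtain x y where xy: "e = {x, y}" "x \<in> A \<union> B" "y \<in> A \<union> B" "x \<noteq> y"
      by (auto elim: pairsE)
    consider "x \<in> A" "y \<in> A" | "x \<in> A" "y \<in> B" | "y \<in> A" "x \<in> B" | "x \<in> B" "y \<in> B"
      using xy by blast
    then show ?thesis
    proof cases
      case 1
      with xy e show ?thesis
        by (auto simp: clique_pairs_def pairs_def)
    next
      case 2
      with xy cross show ?thesis
        by simp
    next
      case 3
      with xy cross[of y x] show ?thesis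
        by (simp add: insert_commute)
    next
      case 4
      with xy have "e \<in> pairs B"
        by (auto simp: pairs_def)
      with e assms(5) show ?thesis
        by (auto simp: clique_pairs_def split: if_splits)
    qed
  qed
  with assms show ?thesis
    unfolding split_in_def clique_pairs_def by (auto split: if_splits)
qed

text \<open>One colour has at least half of the cross pairs, hence contains a biclique between the
  cliques. The clique of the opposite colour becomes the distinguished part of a Type 1 pattern, and
  the other clique has the same colour as the biclique. The biclique property is a hypothesis so
  that the caller can fix \<open>k\<close> and \<gamma> once.\<close>

lemma split_in_if_both_cliques:
  fixes G :: "'a bigraph"
  assumes G: "bicolored G" "complete_graph G"
    and kst: "\<And>(A :: 'a set) (B :: 'a set) P. finite A \<Longrightarrow> finite B \<Longrightarrow> card A = k \<Longrightarrow> card B = k \<Longrightarrow>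
      \<gamma> * real k ^ 2 \<le> real (card {p \<in> A \<times> B. P (fst p) (snd p)}) \<Longrightarrow>
      \<exists>T U. T \<subseteq> A \<and> U \<subseteq> B \<and> card T = s \<and> card U = s \<and> (\<forall>x\<in>T. \<forall>y\<in>U. P x y)"
    and \<gamma>: "\<gamma> \<le> 1 / 2"
    and AB: "A \<subseteq> verts G" "B \<subseteq> verts G" "A \<inter> B = {}" "card A = k" "card B = k"
      "pairs A \<subseteq> colour_class G c" "pairs B \<subseteq> colour_class G (opp c)"
  shows "\<exists>d two A' B'. split_in G d two A' B' \<and> card A' = s \<and> card B' = s"
proof -
  have fin: "finite A" "finite B"
    using AB(1,2) bicoloredD(1)[OF G(1)] finite_subset by blast+
  let ?E = "\<lambda>d. {p \<in> A \<times> B. {fst p, snd p} \<in> colour_class G d}"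
  have "{x, y} \<in> colour_class G c \<or> {x, y} \<in> colour_class G (opp c)" if "x \<in> A" "y \<in> B" for x y
    using that AB(1-3) by (intro complete_classE[OF G(2)]) auto
  then have "A \<times> B \<subseteq> ?E c \<union> ?E (opp c)"
    by fastforce
  then have "card (A \<times> B) \<le> card (?E c \<union> ?E (opp c))"
    using fin by (intro card_mono) auto
  also have "\<dots> \<le> card (?E c) + card (?E (opp c))"
    by (rule card_Un_le)
  finally have "real (card (A \<times> B)) \<le> real (card (?E c)) + real (card (?E (opp c)))"
    by linarith
  then have sum: "real k ^ 2 \<le> real (card (?E c)) + real (card (?E (opp c)))"
    using AB by (simp add: card_cartesian_product power2_eq_square)
  have "\<gamma> * real k ^ 2 \<le> 1 / 2 * real k ^ 2"
    using \<gamma> by (intro mult_right_mono) auto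
  with sum have "\<gamma> * real k ^ 2 \<le> real (card (?E c)) \<or> \<gamma> * real k ^ 2 \<le> real (card (?E (opp c)))"
    by linarith
  then obtain d where d: "d = c \<or> d = opp c" "\<gamma> * real k ^ 2 \<le> real (card (?E d))"
    by blast
  obtain T U where TU: "T \<subseteq> A" "U \<subseteq> B" "card T = s" "card U = s"
      "\<forall>x\<in>T. \<forall>y\<in>U. {x, y} \<in> colour_class G d"
    using kst[of A B "\<lambda>x y. {x, y} \<in> colour_class G d"] fin AB(4,5) d(2) by blast
  have T: "T \<subseteq> verts G" "pairs T \<subseteq> colour_class G c"
    and U: "U \<subseteq> verts G" "pairs U \<subseteq> colour_class G (opp c)" and "T \<inter> U = {}"
    using TU(1,2) AB pairs_mono[of T A] pairs_mono[of U B] by auto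
  from d(1) show ?thesis
  proof
    assume "d = c"
    with TU(5) have "{y, x} \<in> colour_class G c" if "x \<in> T" "y \<in> U" for x y
      using that by (metis insert_commute)
    with T U \<open>T \<inter> U = {}\<close> have "split_in G (opp c) False U T"
      by (intro split_inI) auto
    with TU show ?thesis
      by blast
  next
    assume "d = opp c"
    with T U TU \<open>T \<inter> U = {}\<close> have "split_in G c False T U"
      by (intro split_inI) auto
    with TU show ?thesis
      by blast
  qed
qed

text \<open>A set that could be added would be disjoint from every member, contradicting maximality.
  The empty set is excepted because it is disjoint even from itself and may already be a
  member.\<close>

lemma exists_maximal_disjoint_family:
  assumes "finite V"
  obtains \<C> where "\<forall>P\<in>\<C>. P \<subseteq> V \<and> Q P" "pairwise disjnt \<C>"
    "\<forall>P. P \<subseteq> V - \<Union>\<C> \<and> P \<noteq> {} \<longrightarrow> \<not> Q P"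
proof -
  let ?\<A> = "{\<C>. (\<forall>P\<in>\<C>. P \<subseteq> V \<and> Q P) \<and> pairwise disjnt \<C>}"
  have "?\<A> \<subseteq> Pow (Pow V)"
    by auto
  then have "finite ?\<A>"
    using assms finite_subset by blast
  moreover have "{} \<in> ?\<A>"
    by simp
  ultimately obtain \<C> where \<C>: "\<C> \<in> ?\<A>" and max: "\<And>\<D>. \<D> \<in> ?\<A> \<Longrightarrow> \<C> \<subseteq> \<D> \<Longrightarrow> \<C> = \<D>"
    using finite_has_maximal[of ?\<A>] by (metis (no_types, lifting) empty_iff)
  have "\<not> Q P" if P: "P \<subseteq> V - \<Union>\<C>" "P \<noteq> {}" for P
  proof
    assume "Q P"
    have "disjnt P R" if "R \<in> \<C>" for R
      using P that by (auto simp: disjnt_def)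
    then have "insert P \<C> \<in> ?\<A>"
      using \<C> P \<open>Q P\<close> by (auto simp: pairwise_insert disjnt_sym)
    then have "P \<in> \<C>"
      using max by blast
    with P show False
      by blast
  qed
  with \<C> that show ?thesis
    by blast
qed

text \<open>
  Disjoint cliques of both colours yield Type 1, since one colour is dense between them. Otherwise
  almost all vertices are covered by disjoint cliques of one colour \<open>c\<close>; the other colour has
  positive density and hence is dense between two of them, which yields Type 2.
\<close>

theorem balanced_complete_contains_split:
  assumes \<epsilon>: "0 < \<epsilon>"
  shows "\<exists>N. \<forall>G :: 'a bigraph. bicolored G \<and> complete_graph G \<and> balanced \<epsilon> G \<and> N \<le> card (verts G) \<longrightarrow>
    (\<exists>c two A B. split_in G c two A B \<and> card A = s \<and> card B = s)"
proof -
  \<comment> \<open>The bound 1/2 serves cliques of different colours. The bound \<epsilon>/8 keeps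
    the cross pairs of the other colour below a quarter of the roughly \<epsilon> * n^2 / 2 pairs
    that balance demands.\<close>
  define \<gamma> where "\<gamma> = min (1 / 2) (\<epsilon> / 8)"
  have \<gamma>: "0 < \<gamma>" "\<gamma> \<le> 1 / 2" "\<gamma> \<le> \<epsilon> / 8"
    using \<epsilon> by (auto simp: \<gamma>_def)
  obtain k0 where k0: "\<forall>k\<ge>k0. \<forall>(A :: 'a set) (B :: 'a set). \<forall>P. finite A \<and> finite B \<and> card A = k \<and> card B = k \<and>
    \<gamma> * real k ^ 2 \<le> real (card {p \<in> A \<times> B. P (fst p) (snd p)}) \<longrightarrow>
    (\<exists>T U. T \<subseteq> A \<and> U \<subseteq> B \<and> card T = s \<and> card U = s \<and> (\<forall>x\<in>T. \<forall>y\<in>U. P x y))"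
    by (rule exE[OF dense_bipartite_contains_biclique[OF \<gamma>(1), of s]])
  \<comment> \<open>Cliques must be nonempty for the maximality of the disjoint family to
    apply.\<close>
  define k where "k = max k0 1"
  have k1: "1 \<le> k"
    by (simp add: k_def)
  have kst: "\<exists>T U. T \<subseteq> A \<and> U \<subseteq> B \<and> card T = s \<and> card U = s \<and> (\<forall>x\<in>T. \<forall>y\<in>U. P x y)"
    if "finite A" "finite B" "card A = k" "card B = k"
      "\<gamma> * real k ^ 2 \<le> real (card {p \<in> A \<times> B. P (fst p) (snd p)})" for A :: "'a set" and B :: "'a set" and P
    using k0[rule_format, of k A B P] that by (simp add: k_def)
  obtain r where r: "\<forall>(V :: 'a set) (E :: 'a set set). finite V \<and> card V \<ge> r \<longrightarrow>
    (\<exists>R\<subseteq>V. card R = Suc k \<and> clique R E \<or> card R = Suc k \<and> indep R E)"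
    using ramsey2[of "Suc k" "Suc k"] by blast
  \<comment> \<open>The counting will end in 3 * \<epsilon> * n \<le> 8 * r + 4 * \<epsilon>, which
    fails once \<epsilon> * n \<ge> 8 * r + 4 * \<epsilon>.\<close>
  define N where "N = nat \<lceil>8 * real r / \<epsilon>\<rceil> + 4"
  show ?thesis
  proof (intro exI[of _ N] allI impI, elim conjE)
    fix G :: "'a bigraph"
    assume G: "bicolored G" "complete_graph G" and bal: "balanced \<epsilon> G" and N: "N \<le> card (verts G)"
    define n where "n = card (verts G)"
    have fV: "finite (verts G)"
      using bicoloredD(1)[OF G(1)] .
    show "\<exists>c two A B. split_in G c two A B \<and> card A = s \<and> card B = s"
    proof (rule ccontr)
      assume none: "\<not> ?thesis"
      have not_both: "\<not> (\<exists>A B. A \<subseteq> verts G \<and> B \<subseteq> verts G \<and> card A = Suc k \<and> card B = Suc k \<and>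
          pairs A \<subseteq> colour_class G c \<and> pairs B \<subseteq> colour_class G (opp c))" for c
      proof (intro notI, elim exE conjE)
        fix A B assume AB: "A \<subseteq> verts G" "B \<subseteq> verts G" "card A = Suc k" "card B = Suc k"
          "pairs A \<subseteq> colour_class G c" "pairs B \<subseteq> colour_class G (opp c)"
        have "finite A" "finite B"
          using AB fV finite_subset by blast+
        \<comment> \<open>A common pair would have both colours, so the cliques share at most one
          vertex. This is why they have size \<open>Suc k\<close>: deleting that vertex leaves
          \<open>k\<close>.\<close>
        have "pairs (A \<inter> B) = {}"
          using AB bicoloredD(4)[OF G(1), of c] unfolding pairs_Int[symmetric] by blast
        then have "card (A \<inter> B) choose 2 = 0"
          using \<open>finite A\<close> by (simp add: card_pairs[symmetric])
        then have "card (A \<inter> B) \<le> 1"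
          by (auto simp: binomial_eq_0_iff)
        then have "k \<le> card (A - B)"
          using \<open>finite A\<close> AB by (simp add: card_Diff_subset_Int)
        then obtain A' where A': "A' \<subseteq> A - B" "card A' = k"
          by (auto elim: obtain_subset_with_card_n)
        obtain B' where B': "B' \<subseteq> B" "card B' = k"
          using AB by (metis le_SucI le_refl obtain_subset_with_card_n)
        have "\<exists>d two A'' B''. split_in G d two A'' B'' \<and> card A'' = s \<and> card B'' = s"
        proof (rule split_in_if_both_cliques[OF G _ \<gamma>(2), where k = k and A = A' and B = B' and c = c])
          fix A B :: "'a set" and P
          assume "finite A" "finite B" "card A = k" "card B = k"
            "\<gamma> * real k ^ 2 \<le> real (card {p \<in> A \<times> B. P (fst p) (snd p)})"
          then show "\<exists>T U. T \<subseteq> A \<and> U \<subseteq> B \<and> card T = s \<and> card U = s \<and> (\<forall>x\<in>T. \<forall>y\<in>U. P x y)"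
            by (rule kst)
        next
          show "pairs A' \<subseteq> colour_class G c" "pairs B' \<subseteq> colour_class G (opp c)"
            using A'(1) B'(1) AB(5,6) pairs_mono[of A' A] pairs_mono[of B' B] by blast+
        qed (use A' B' AB in auto)
        with none show False
          by blast
      qed
      have ram: "\<exists>d R. (d = Red \<or> d = Blue) \<and> R \<subseteq> W \<and> card R = Suc k \<and> pairs R \<subseteq> colour_class G d"
        if W: "W \<subseteq> verts G" "r \<le> card W" for W
      proof -
        obtain R where R: "R \<subseteq> W" "card R = Suc k"
            "clique R (colour_class G Red) \<or> indep R (colour_class G Red)"
          using r W finite_subset[OF W(1) fV] by blast
        from R(3) have "pairs R \<subseteq> colour_class G Red \<or> pairs R \<subseteq> colour_class G Blue"
        proof
          assume "clique R (colour_class G Red)"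
          then show ?thesis
            by (auto simp: clique_def elim!: pairsE)
        next
          assume ind: "indep R (colour_class G Red)"
          have "e \<in> colour_class G Blue" if "e \<in> pairs R" for e
          proof -
            from that obtain x y where "e = {x, y}" "x \<in> R" "y \<in> R" "x \<noteq> y"
              by (rule pairsE)
            with ind R(1) W(1) complete_classE[OF G(2), of x y Red] show ?thesis
              by (auto simp: indep_def)
          qed
          then show ?thesis
            by blast
        qed
        with R show ?thesis
          by blast
      qed
      \<comment> \<open>The colour of Ramsey's theorem can be fixed globally: if a red clique of
        size \<open>Suc k\<close> exists anywhere, no blue one does; otherwise every clique found is
        blue.\<close>
      have "\<exists>c. \<forall>W\<subseteq>verts G. r \<le> card W \<longrightarrow>
          (\<exists>R\<subseteq>W. card R = Suc k \<and> pairs R \<subseteq> colour_class G c)"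
      proof (cases "\<exists>A\<subseteq>verts G. card A = Suc k \<and> pairs A \<subseteq> colour_class G Red")
        case True
        then have "\<not> (\<exists>B\<subseteq>verts G. card B = Suc k \<and> pairs B \<subseteq> colour_class G Blue)"
          using not_both[of Red] unfolding opp.simps by blast
        with ram show ?thesis
          by (intro exI[of _ Red]) (metis order_trans)
      next
        case False
        with ram show ?thesis
          by (intro exI[of _ Blue]) (metis order_trans)
      qed
      then obtain c where c: "\<And>W. W \<subseteq> verts G \<Longrightarrow> r \<le> card W \<Longrightarrow>
          \<exists>R\<subseteq>W. card R = Suc k \<and> pairs R \<subseteq> colour_class G c"
        by blast
      define Q where "Q P \<longleftrightarrow> card P = k \<and> pairs P \<subseteq> colour_class G c" for P
      obtain \<C> where \<C>: "\<forall>P\<in>\<C>. P \<subseteq> verts G \<and> Q P" "pairwise disjnt \<C>"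
          "\<forall>P. P \<subseteq> verts G - \<Union>\<C> \<and> P \<noteq> {} \<longrightarrow> \<not> Q P"
        using exists_maximal_disjoint_family[OF fV, of Q] .
      have \<C>V: "P \<subseteq> verts G" and \<C>k: "card P = k" and \<C>c: "pairs P \<subseteq> colour_class G c"
        if "P \<in> \<C>" for P
        using that \<C>(1) by (auto simp: Q_def)
      define L where "L = verts G - \<Union>\<C>"
      have finP: "finite P" if "P \<in> \<C>" for P
        using \<C>V[OF that] fV by (rule finite_subset)
      have f\<C>: "finite \<C>"
        using \<C>V fV by (intro finite_subset[of \<C> "Pow (verts G)"]) auto
      have L: "card L \<le> r"
      proof (rule ccontr)
        assume "\<not> card L \<le> r"
        then obtain R where R: "R \<subseteq> L" "card R = Suc k" "pairs R \<subseteq> colour_class G c"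
          using c[of L] by (auto simp: L_def)
        obtain P where P: "P \<subseteq> R" "card P = k"
          using R(2) by (metis le_SucI le_refl obtain_subset_with_card_n)
        moreover have "P \<noteq> {}"
          using P k1 by auto
        ultimately show False
          using \<C>(3)[rule_format, of P] R pairs_mono[of P R] unfolding L_def Q_def by blast
      qed
      have "card \<C> * k = card (\<Union>\<C>)"
        using \<C>k card_Union_disjoint[OF \<C>(2) finP] by simp
      also have "\<dots> \<le> n"
        unfolding n_def using \<C>V fV by (intro card_mono) auto
      finally have \<C>n: "real (card \<C>) * real k \<le> real n"
        by (metis of_nat_mono of_nat_mult)
      define E where "E P Q = {p \<in> P \<times> Q. {fst p, snd p} \<in> colour_class G (opp c)}" for P Q
      have EPQ: "real (card (E P Q)) \<le> \<gamma> * real k ^ 2" if PQ: "P \<in> \<C>" "Q \<in> \<C>" "P \<noteq> Q" for P Q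
      proof (rule ccontr)
        assume "\<not> ?thesis"
        then have "\<gamma> * real k ^ 2 \<le> real (card {p \<in> P \<times> Q. {fst p, snd p} \<in> colour_class G (opp c)})"
          by (simp add: E_def)
        then obtain T U where TU: "T \<subseteq> P" "U \<subseteq> Q" "card T = s" "card U = s"
            "\<forall>x\<in>T. \<forall>y\<in>U. {x, y} \<in> colour_class G (opp c)"
          using kst[of P Q "\<lambda>x y. {x, y} \<in> colour_class G (opp c)"] PQ \<C>k finP by blast
        have "P \<inter> Q = {}"
          using PQ \<C>(2) by (auto simp: pairwise_def disjnt_def)
        moreover have "T \<subseteq> verts G" "U \<subseteq> verts G" "pairs T \<subseteq> colour_class G c"
            "pairs U \<subseteq> colour_class G c"
          using TU(1,2) PQ \<C>V \<C>c pairs_mono[of T P] pairs_mono[of U Q] by blast+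
        ultimately have "split_in G c True T U"
          using TU by (intro split_inI) auto
        with TU none show False
          by blast
      qed
      define W where "W = {w \<in> \<C> \<times> \<C>. fst w \<noteq> snd w}"
      have W: "W \<subseteq> \<C> \<times> \<C>" "finite W"
        using f\<C> by (auto simp: W_def)
      let ?mk = "\<lambda>p :: 'a \<times> 'a. {fst p, snd p}"
      \<comment> \<open>Pairs inside a member of the family have colour \<open>c\<close>, so any
        pair of the other colour meets \<open>L\<close> or joins two distinct members.\<close>
      have "colour_class G (opp c) \<subseteq> ?mk ` (L \<times> verts G \<union> (\<Union>w\<in>W. E (fst w) (snd w)))"
      proof
        fix e assume e: "e \<in> colour_class G (opp c)"
        then have "e \<in> pairs (verts G)"
          using bicoloredD(2)[OF G(1)] by blast
        then obtain x y where xy: "e = {x, y}" "x \<in> verts G" "y \<in> verts G" "x \<noteq> y"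
          by (rule pairsE)
        consider "x \<in> L" | "y \<in> L" | "x \<notin> L" "y \<notin> L"
          by blast
        then show "e \<in> ?mk ` (L \<times> verts G \<union> (\<Union>w\<in>W. E (fst w) (snd w)))"
        proof cases
          case 1
          with xy show ?thesis
            by (intro image_eqI[of _ _ "(x, y)"]) auto
        next
          case 2
          with xy show ?thesis
            by (intro image_eqI[of _ _ "(y, x)"]) auto
        next
          case 3
          with xy obtain P Q where PQ: "P \<in> \<C>" "Q \<in> \<C>" "x \<in> P" "y \<in> Q"
            by (auto simp: L_def)
          have "P \<noteq> Q"
          proof
            assume "P = Q"
            with PQ xy have "e \<in> pairs P"
              by (auto simp: pairs_def)
            with PQ \<C>c e bicoloredD(4)[OF G(1), of c] show False
              by blast
          qed
          with PQ e xy have "(P, Q) \<in> W" "(x, y) \<in> E P Q"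
            by (auto simp: W_def E_def)
          with xy show ?thesis
            by (intro image_eqI[of _ _ "(x, y)"]) (auto intro!: bexI[of _ "(P, Q)"])
        qed
      qed
      moreover have fE: "finite (L \<times> verts G \<union> (\<Union>w\<in>W. E (fst w) (snd w)))"
        using fV W finP by (auto simp: L_def E_def W_def)
      ultimately have "card (colour_class G (opp c)) \<le> card (L \<times> verts G \<union> (\<Union>w\<in>W. E (fst w) (snd w)))"
        using surj_card_le by blast
      also have "\<dots> \<le> card (L \<times> verts G) + card (\<Union>w\<in>W. E (fst w) (snd w))"
        by (rule card_Un_le)
      also have "\<dots> \<le> card L * n + (\<Sum>w\<in>W. card (E (fst w) (snd w)))"
        using W by (simp add: card_cartesian_product n_def card_UN_le)
      finally have "real (card (colour_class G (opp c))) \<le>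
          real (card L * n + (\<Sum>w\<in>W. card (E (fst w) (snd w))))"
        by (rule of_nat_mono)
      then have 1: "real (card (colour_class G (opp c))) \<le>
          real (card L) * real n + (\<Sum>w\<in>W. real (card (E (fst w) (snd w))))"
        by simp
      have 2: "real (card L) * real n \<le> real r * real n"
        using L by (intro mult_right_mono) auto
      have "(\<Sum>w\<in>W. real (card (E (fst w) (snd w)))) \<le> (\<Sum>w\<in>W. \<gamma> * real k ^ 2)"
        by (intro sum_mono EPQ) (auto simp: W_def)
      also have "\<dots> = real (card W) * (\<gamma> * real k ^ 2)"
        by simp
      also have "\<dots> \<le> real (card \<C> * card \<C>) * (\<gamma> * real k ^ 2)"
      proof (rule mult_right_mono)
        have "card W \<le> card (\<C> \<times> \<C>)"
          using W f\<C> by (intro card_mono) auto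
        then show "real (card W) \<le> real (card \<C> * card \<C>)"
          by (simp only: card_cartesian_product of_nat_le_iff)
      qed (use \<gamma> in auto)
      also have "\<dots> = \<gamma> * (real (card \<C>) * real k) ^ 2"
        by (simp add: power2_eq_square mult_ac)
      also have "\<dots> \<le> \<epsilon> / 8 * real n ^ 2"
        using \<gamma> \<C>n by (intro mult_mono power_mono) auto
      finally have "real (card (colour_class G (opp c))) \<le> real r * real n + \<epsilon> / 8 * real n ^ 2"
        using 1 2 by linarith
      moreover have "\<epsilon> * real (n choose 2) \<le> real (card (colour_class G (opp c)))"
        using bal card_edges_complete[OF G] by (simp add: balanced_def n_def)
      ultimately have "real n * (\<epsilon> * (real n - 1) / 2) \<le> real n * (real r + \<epsilon> / 8 * real n)"
        by (simp add: choose_two_real power2_eq_square algebra_simps)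
      moreover have n4: "8 * real r / \<epsilon> + 4 \<le> real n"
        using N unfolding N_def n_def by linarith
      moreover have "0 < real n"
        using N by (simp add: N_def n_def)
      ultimately have "\<epsilon> * (real n - 1) / 2 \<le> real r + \<epsilon> / 8 * real n"
        by (simp only: mult_le_cancel_left_pos)
      moreover have "8 * real r + 4 * \<epsilon> \<le> \<epsilon> * real n"
        using n4 \<epsilon> by (simp add: field_simps)
      ultimately show False
        using \<epsilon> by (simp add: algebra_simps)
    qed
  qed
qed

subsection \<open>The equivalences\<close>

text \<open>With x = 2 * n + 1 and y = 2 * a + 1 the equation reads x^2 - 2 * y^2 = -1. The
  induction starts at x = y = 1 and multiplies x + y * sqrt 2 by the unit 3 + 2 * sqrt 2. Here
  \<open>a\<close> and \<open>n\<close> are one less than the sizes of the clique and of the whole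
  graph.\<close>

lemma pell_solutions_unbounded:
  "\<exists>a n :: nat. N \<le> n \<and> a \<le> n \<and> 2 * (a * a + a) = n * n + n"
proof (induction N)
  case 0
  show ?case
    by (intro exI[of _ 0]) simp
next
  case (Suc N)
  then obtain a n where an: "N \<le> n" "a \<le> n" "2 * (a * a + a) = n * n + n"
    by blast
  define a' n' where "a' = 3 * a + 2 * n + 2" and "n' = 4 * a + 3 * n + 3"
  have "2 * (a' * a' + a') = 18 * (a * a) + 8 * (n * n) + 24 * (a * n) + 30 * a + 20 * n + 12"
    by (simp add: a'_def algebra_simps)
  moreover have "n' * n' + n' = 16 * (a * a) + 9 * (n * n) + 24 * (a * n) + 28 * a + 21 * n + 12"
    by (simp add: n'_def algebra_simps)
  ultimately have "2 * (a' * a' + a') = n' * n' + n'"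
    using an(3) by simp
  moreover have "Suc N \<le> n'" "a' \<le> n'"
    using an by (auto simp: a'_def n'_def)
  ultimately show ?case
    by blast
qed

text \<open>
  The requirement that exactly half of all pairs are clique pairs is a Pell equation for one
  clique; for two cliques of sizes \<open>a\<close> and \<open>b\<close> it reads \<open>(a - b)\<^sup>2 = a + b\<close>, which is solved by
  consecutive triangular numbers.
\<close>

lemma exactly_half_clique_pairs:
  "\<exists>A B :: nat set. finite A \<and> finite B \<and> A \<inter> B = {} \<and> N \<le> card (A \<union> B) \<and>
     2 * card (clique_pairs two A B) = card (A \<union> B) choose 2"
proof (cases two)
  case False
  obtain a n where an: "N \<le> n" "a \<le> n" "2 * (a * a + a) = n * n + n"
    using pell_solutions_unbounded by blast
  have "{..a} \<union> {Suc a..n} = {..n}"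
    using an by auto
  moreover have "2 * (2 * (Suc a choose 2)) = 2 * (Suc n choose 2)"
    unfolding double_choose_two using an(3) by (simp add: algebra_simps)
  ultimately show ?thesis
    using an(1) False
    by (intro exI[of _ "{..a}"] exI[of _ "{Suc a..n}"]) (auto simp: clique_pairs_def card_pairs)
next
  case True
  define a b where "a = Suc N choose 2" and "b = N choose 2"
  have ab: "a = b + N"
    by (simp add: a_def b_def numeral_2_eq_2)
  have b2: "2 * b + N = N * N"
    unfolding b_def double_choose_two by (cases N) auto
  have union: "{..<a} \<union> {a..<a + b} = {..<a + b}"
    by auto
  have "card (clique_pairs two {..<a} {a..<a + b}) = card (pairs {..<a}) + card (pairs {a..<a + b})"
    unfolding clique_pairs_def using True
    by (simp add: card_Un_disjoint finite_pairs pairs_disjoint ivl_disj_int)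
  then have cp: "card (clique_pairs two {..<a} {a..<a + b}) = (a choose 2) + (b choose 2)"
    by (simp add: card_pairs)
  have "2 * real b + real N = real N * real N"
    using b2 by (metis of_nat_add of_nat_mult of_nat_numeral)
  moreover have "2 * (real (a choose 2) + real (b choose 2)) - real ((a + b) choose 2) =
      (real N * real N - (2 * real b + real N)) / 2"
    unfolding choose_two_real ab by (simp add: field_simps)
  ultimately have "2 * (real (a choose 2) + real (b choose 2)) = real ((a + b) choose 2)"
    by simp
  then have "real (2 * ((a choose 2) + (b choose 2))) = real ((a + b) choose 2)"
    by simp
  then have "2 * ((a choose 2) + (b choose 2)) = (a + b) choose 2"
    by (simp only: of_nat_eq_iff)
  moreover have "N \<le> a + b"
    by (simp add: ab)
  ultimately show ?thesis
    using cp by (intro exI[of _ "{..<a}"] exI[of _ "{a..<a + b}"]) (auto simp: union)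
qed

lemma balanced_if_exactly_half:
  assumes "\<epsilon> \<le> 1 / 2" "finite A" "finite B"
    "2 * card (clique_pairs two A B) = card (A \<union> B) choose 2"
  shows "balanced \<epsilon> (split_graph c two A B)"
proof -
  let ?G = "split_graph c two A B" and ?h = "card (clique_pairs two A B)"
  have G: "bicolored ?G" "complete_graph ?G"
    using assms by (auto intro: split_graph_complete)
  have e: "card (edges ?G) = 2 * ?h"
    using card_edges_complete[OF G] assms(4) by simp
  then have "card (colour_class ?G d) = ?h" for d
    using bicoloredD(5)[OF G(1), of c]
    by (cases "d = c") (auto simp: neq_iff_eq_opp simp del: split_graph_simps(4))
  moreover have "\<epsilon> * real (2 * ?h) \<le> 1 / 2 * real (2 * ?h)"
    using assms(1) by (intro mult_right_mono) auto
  ultimately show ?thesis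
    unfolding balanced_def e by simp
qed

text \<open>The parts may differ in size, as they do in the exactly balanced graphs that provide the
  members in (2) to (3).\<close>

definition split_member :: "colour \<Rightarrow> bool \<Rightarrow> 'a bigraph \<Rightarrow> bool" where
  "split_member c two F \<longleftrightarrow> (\<exists>A B :: nat set. finite A \<and> finite B \<and> A \<inter> B = {} \<and>
     contains (split_graph c two A B) F)"

text \<open>Both parts can be enlarged to the size of the larger one. The 1 in the maximum covers
  empty parts, as an unavoidable graph requires t \<ge> 1.\<close>

lemma split_member_equal_parts:
  assumes "split_member c two F"
  shows "\<exists>t\<ge>1. \<exists>A B :: nat set. finite A \<and> finite B \<and> A \<inter> B = {} \<and> card A = t \<and> card B = t \<and>
    contains (split_graph c two A B) F"
proof -
  obtain A B :: "nat set" where AB: "finite A" "finite B" "A \<inter> B = {}"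
      "contains (split_graph c two A B) F"
    using assms unfolding split_member_def by blast
  define t where "t = max 1 (max (card A) (card B))"
  have "contains (split_graph c two {..<t} {t..<2 * t}) (split_graph c two A B)"
    using AB by (intro split_in_contains[OF split_in_split_graph]) (auto simp: t_def)
  then have "contains (split_graph c two {..<t} {t..<2 * t}) F"
    using AB(4) by (rule contains_trans)
  then show ?thesis
    by (intro exI[of _ t] conjI exI[of _ "{..<t}"] exI[of _ "{t..<2 * t}"]) (auto simp: t_def)
qed

lemma unavoidable_type1_contains_iff:
  "(\<exists>t. \<exists>H :: nat bigraph. unavoidable_type1 c t H \<and> contains H F) \<longleftrightarrow> split_member c False F"
proof
  assume "split_member c False F"
  from split_member_equal_parts[OF this]
  show "\<exists>t. \<exists>H :: nat bigraph. unavoidable_type1 c t H \<and> contains H F"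
    unfolding unavoidable_type1_iff by blast
qed (auto simp: unavoidable_type1_iff split_member_def)

lemma unavoidable_type2_contains_iff:
  "(\<exists>t. \<exists>H :: nat bigraph. unavoidable_type2 c t H \<and> contains H F) \<longleftrightarrow> split_member c True F"
proof
  assume "split_member c True F"
  from split_member_equal_parts[OF this]
  show "\<exists>t. \<exists>H :: nat bigraph. unavoidable_type2 c t H \<and> contains H F"
    unfolding unavoidable_type2_iff by blast
qed (auto simp: unavoidable_type2_iff split_member_def)

text \<open>Four members of the family suffice, one for each colour and type. As \<open>s\<close>
  bounds all four part sizes, the member matching the pattern that occurs embeds into it.\<close>

lemma balanced_complete_contains_member:
  fixes \<F> :: "'a bigraph set"
  assumes \<epsilon>: "0 < \<epsilon>" and mem: "\<And>c two. \<exists>F\<in>\<F>. split_member c two F"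
  obtains N where "\<And>G :: 'b bigraph. bicolored G \<Longrightarrow> complete_graph G \<Longrightarrow> balanced \<epsilon> G \<Longrightarrow>
    N \<le> card (verts G) \<Longrightarrow> \<exists>F\<in>\<F>. contains G F"
proof -
  have "\<exists>t. \<exists>F\<in>\<F>. \<exists>A B :: nat set. finite A \<and> finite B \<and> A \<inter> B = {} \<and> card A = t \<and> card B = t \<and>
      contains (split_graph c two A B) F" for c two
    using mem[of c two] split_member_equal_parts by meson
  then obtain t where t: "\<And>c two. \<exists>F\<in>\<F>. \<exists>A B :: nat set. finite A \<and> finite B \<and> A \<inter> B = {} \<and>
      card A = t c two \<and> card B = t c two \<and> contains (split_graph c two A B) F"
    by metis
  define s where "s = t Red True + t Red False + t Blue True + t Blue False"
  have ts: "t c two \<le> s" for c two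
    by (cases c; cases two) (auto simp: s_def)
  obtain N where N: "\<forall>G :: 'b bigraph. bicolored G \<and> complete_graph G \<and> balanced \<epsilon> G \<and>
      N \<le> card (verts G) \<longrightarrow> (\<exists>c two A B. split_in G c two A B \<and> card A = s \<and> card B = s)"
    by (rule exE[OF balanced_complete_contains_split[OF \<epsilon>]])
  have "\<exists>F\<in>\<F>. contains G F" if G: "bicolored G" "complete_graph G" "balanced \<epsilon> G" "N \<le> card (verts G)"
    for G :: "'b bigraph"
  proof -
    obtain c two A' B' where A'B': "split_in G c two A' B'" "card A' = s" "card B' = s"
      using N G by blast
    then have "A' \<union> B' \<subseteq> verts G"
      by (simp add: split_in_def)
    then have fin: "finite A'" "finite B'"
      using finite_subset[OF _ bicoloredD(1)[OF G(1)]] by auto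
    obtain F and A B :: "nat set" where F: "F \<in> \<F>" "finite A" "finite B" "A \<inter> B = {}"
        "card A = t c two" "card B = t c two" "contains (split_graph c two A B) F"
      using t[of c two] by blast
    have "contains G (split_graph c two A B)"
      using A'B'(2,3) F fin ts by (intro split_in_contains[OF A'B'(1)]) auto
    then have "contains G F"
      using F(7) by (rule contains_trans)
    with F(1) show ?thesis
      by blast
  qed
  with that show ?thesis
    by blast
qed

section \<open>The implications between the three statements\<close>

lemma ramsey_number_finite_iff:
  "ramsey_number \<epsilon> \<F> < \<infinity> \<longleftrightarrow> (\<exists>N. \<forall>G :: nat bigraph. bicolored G \<and> complete_graph G \<and>
     balanced \<epsilon> G \<and> N \<le> card (verts G) \<longrightarrow> (\<exists>F\<in>\<F>. contains G F))"
proof -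
  let ?X = "{enat N | N. \<forall>G :: nat bigraph. bicolored G \<and> complete_graph G \<and> balanced \<epsilon> G \<and>
    N \<le> card (verts G) \<longrightarrow> (\<exists>F\<in>\<F>. contains G F)}"
  have "Inf ?X < \<infinity> \<longleftrightarrow> (\<exists>x\<in>?X. x < \<infinity>)"
    by (rule Inf_less_iff)
  also have "\<dots> \<longleftrightarrow> (\<exists>N. \<forall>G :: nat bigraph. bicolored G \<and> complete_graph G \<and>
     balanced \<epsilon> G \<and> N \<le> card (verts G) \<longrightarrow> (\<exists>F\<in>\<F>. contains G F))"
    by auto
  finally show ?thesis
    unfolding ramsey_number_def .
qed

lemma ramsey_number_finite_if_density_less_1:
  assumes \<epsilon>: "0 < \<epsilon>" "\<epsilon> \<le> 1 / 2" and less: "ex_density \<epsilon> \<F> < 1"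
  shows "ramsey_number \<epsilon> \<F> < \<infinity>"
proof -
  have "\<forall>\<^sub>F n in sequentially. ex_ratio \<epsilon> \<F> n < 1"
    using ex_ratio_tendsto[OF \<epsilon>] less by (rule order_tendstoD(2))
  then obtain N where N: "\<And>n. N \<le> n \<Longrightarrow> ex_ratio \<epsilon> \<F> n < 1"
    by (auto simp: eventually_sequentially)
  \<comment> \<open>With fewer than 2 vertices \<open>n choose 2\<close> is 0, and division by 0
    would make the ratio 0 instead of 1.\<close>
  have "\<exists>F\<in>\<F>. contains G F" if G: "bicolored G" "complete_graph G" "balanced \<epsilon> G"
    and n: "max N 2 \<le> card (verts G)" for G :: "nat bigraph"
  proof (rule ccontr)
    assume "\<not> ?thesis"
    with G have "card (edges G) \<le> ex_number \<epsilon> (card (verts G)) \<F>"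
      by (intro card_edges_le_ex_number) (auto simp: admissible_def)
    then have "real (card (verts G) choose 2) \<le> real (ex_number \<epsilon> (card (verts G)) \<F>)"
      using card_edges_complete[OF G(1,2)] by simp
    moreover have "0 < real (card (verts G) choose 2)"
      using n by simp
    ultimately have "1 \<le> ex_ratio \<epsilon> \<F> (card (verts G))"
      by (simp add: ex_ratio_def)
    with N[of "card (verts G)"] n show False
      by simp
  qed
  then show ?thesis
    unfolding ramsey_number_finite_iff by blast
qed

lemma split_member_if_ramsey_number_finite:
  assumes "\<epsilon> \<le> 1 / 2" "ramsey_number \<epsilon> \<F> < \<infinity>"
  shows "\<exists>F\<in>\<F>. split_member c two F"
proof -
  obtain N where N: "\<And>G :: nat bigraph. bicolored G \<Longrightarrow> complete_graph G \<Longrightarrow> balanced \<epsilon> G \<Longrightarrow>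
      N \<le> card (verts G) \<Longrightarrow> \<exists>F\<in>\<F>. contains G F"
    using assms(2) unfolding ramsey_number_finite_iff by blast
  obtain A B :: "nat set" where AB: "finite A" "finite B" "A \<inter> B = {}" "N \<le> card (A \<union> B)"
      "2 * card (clique_pairs two A B) = card (A \<union> B) choose 2"
    using exactly_half_clique_pairs[of N two] by blast
  have "\<exists>F\<in>\<F>. contains (split_graph c two A B) F"
    using N[OF split_graph_complete[OF AB(1,2)] balanced_if_exactly_half[OF assms(1) AB(1,2,5)]] AB(4)
    by simp
  with AB show ?thesis
    unfolding split_member_def by blast
qed

lemma ex_ratio_bounded_if_split_member:
  fixes \<F> :: "'a bigraph set"
  assumes \<epsilon>: "0 < \<epsilon>" and mem: "\<And>c two. \<exists>F\<in>\<F>. split_member c two F"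
  shows "\<exists>\<delta>>0. \<exists>m. \<forall>n\<ge>m. ex_ratio \<epsilon> \<F> n \<le> 1 - \<delta>"
proof -
  obtain N where N: "\<And>G :: nat bigraph. bicolored G \<Longrightarrow> complete_graph G \<Longrightarrow> balanced (\<epsilon> / 2) G \<Longrightarrow>
      N \<le> card (verts G) \<Longrightarrow> \<exists>F\<in>\<F>. contains G F"
    using balanced_complete_contains_member[of "\<epsilon> / 2" \<F>] \<epsilon> mem by (metis half_gt_zero)
  \<comment> \<open>The sample size \<open>m\<close> is fixed before \<open>n\<close>, so large that
    the sampling error, of order m^(3/2), costs each colour a density of at most
    \<epsilon>/4.\<close>
  have "\<forall>\<^sub>F m in sequentially. sqrt (3 * real m ^ 3) \<le> \<epsilon> / 4 * (real m * (real m - 1) / 2)"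
    using \<epsilon> by real_asymp
  then have "\<forall>\<^sub>F m in sequentially. sqrt (3 * real m ^ 3) \<le> \<epsilon> / 4 * real (m choose 2) \<and> 4 \<le> m \<and> N \<le> m"
    unfolding choose_two_real by (intro eventually_conj eventually_ge_at_top)
  then obtain m where m: "sqrt (3 * real m ^ 3) \<le> \<epsilon> / 4 * real (m choose 2)" "4 \<le> m" "N \<le> m"
    by (auto simp: eventually_sequentially)
  define c2 where "c2 = real (m choose 2)"
  have c2: "6 \<le> c2"
  proof -
    have "4 * 3 \<le> real m * (real m - 1)"
      using m(2) by (intro mult_mono) auto
    then show ?thesis
      by (simp add: c2_def choose_two_real)
  qed
  \<comment> \<open>If fewer than \<open>\<delta> * C\<close> pairs are missing, a sample of
    \<open>m\<close> vertices misses fewer than 1/4 of a pair on average, within the 1/3 that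
    \<open>sampling\<close> tolerates.\<close>
  define \<delta> where "\<delta> = 1 / (4 * c2)"
  have \<delta>: "0 < \<delta>" "\<delta> \<le> 1 / 4"
    using c2 by (auto simp: \<delta>_def field_simps)
  have "ex_ratio \<epsilon> \<F> n \<le> 1 - \<delta>" if n: "m \<le> n" for n
  proof (rule ccontr)
    assume large: "\<not> ?thesis"
    define C where "C = real (n choose 2)"
    have C: "0 < C"
      using n m(2) by (simp add: C_def)
    have big: "(1 - \<delta>) * C < real (ex_number \<epsilon> n \<F>)"
      using large C by (simp add: ex_ratio_def C_def pos_less_divide_eq not_le)
    have "0 \<le> (1 - \<delta>) * C"
      using \<delta> C by simp
    with big have "ex_number \<epsilon> n \<F> \<noteq> 0"
      by auto
    then obtain G :: "nat bigraph" where G: "admissible \<epsilon> \<F> G" "card (verts G) = n"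
        "card (edges G) = ex_number \<epsilon> n \<F>"
      by (rule ex_number_attained)
    have bG: "bicolored G" and bal: "balanced \<epsilon> G"
      using G by (auto simp: admissible_def)
    have eG: "edges G \<subseteq> pairs (verts G)" and fV: "finite (verts G)"
      using bG by (auto simp: bicolored_def)
    define q where "q = pair_prob m n"
    have q: "q = c2 / C"
      by (simp add: q_def pair_prob_eq c2_def C_def)
    define M where "M = pairs (verts G) - edges G"
    have "card M = card (pairs (verts G)) - card (edges G)"
      unfolding M_def using eG fV by (intro card_Diff_subset finite_subset[OF eG finite_pairs])
    moreover have "card (edges G) \<le> n choose 2"
      using card_edges_le[OF bG] G(2) by simp
    ultimately have "real (card M) = C - real (card (edges G))"
      by (simp add: card_pairs fV G(2) C_def of_nat_diff)
    then have "real (card M) < \<delta> * C"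
      using big G(3) by (simp add: algebra_simps)
    then have "3 * real (card M) * q < 3 * (\<delta> * C) * q"
      using C c2 by (intro mult_strict_right_mono) (auto simp: q)
    also have "\<dots> = 3 / 4"
      using C c2 by (simp add: q \<delta>_def field_simps)
    finally have small: "3 * real (card M) * q < 1"
      by linarith
    obtain S where S: "S \<subseteq> verts G" "card S = m" "M \<inter> pairs S = {}"
      and cl: "\<And>c. real (card (colour_class G c)) * q - sqrt (3 * real m ^ 3)
        \<le> real (card (colour_class (induced G S) c))"
      using sampling_induced[OF bG m(2), of M] n small G(2) unfolding q_def M_def by auto
    define I where "I = induced G S"
    have bI: "bicolored I"
      unfolding I_def using bG S(1) by (rule bicolored_induced)
    have "pairs S \<subseteq> edges G"
      using S(3) pairs_mono[OF S(1)] by (auto simp: M_def)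
    then have cI: "complete_graph I"
      by (auto simp: complete_graph_def I_def)
    have "card (edges I) = m choose 2"
      using card_edges_complete[OF bI cI] S(2) by (simp add: I_def)
    \<comment> \<open>Since \<delta> \<le> 1/4, \<open>G\<close> has at least 3/4 of all pairs. Each
      colour thus has expected density at least 3/4 * \<epsilon> in the sample, and the error leaves
      \<epsilon>/2.\<close>
    moreover have "\<epsilon> / 2 * c2 \<le> real (card (colour_class I c))" for c
    proof -
      have "\<epsilon> * (3 / 4 * C) \<le> \<epsilon> * real (card (edges G))"
      proof (rule mult_left_mono)
        have "3 / 4 * C \<le> (1 - \<delta>) * C"
          using \<delta> C by (intro mult_right_mono) auto
        with big G(3) show "3 / 4 * C \<le> real (card (edges G))"
          by simp
      qed (use \<epsilon> in simp)
      also have "\<dots> \<le> real (card (colour_class G c))"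
        using bal by (simp add: balanced_def)
      finally have "\<epsilon> * (3 / 4 * C) * q \<le> real (card (colour_class G c)) * q"
        using c2 C by (intro mult_right_mono) (auto simp: q)
      then have "3 / 4 * (\<epsilon> * c2) \<le> real (card (colour_class G c)) * q"
        using C by (simp add: q)
      then show ?thesis
        using cl[of c] m(1) by (simp add: I_def c2_def)
    qed
    ultimately have "balanced (\<epsilon> / 2) I"
      by (simp add: balanced_def c2_def)
    then obtain F where "F \<in> \<F>" "contains I F"
      using N[OF bI cI] m(3) S(2) by (auto simp: I_def)
    moreover have "contains G I"
      unfolding I_def using S(1) by (intro contains_subgraph) auto
    ultimately show False
      using G(1) contains_trans unfolding admissible_def by blast
  qed
  with \<delta>(1) show ?thesis
    by blast
qed

theorem theorem3p3:
  fixes \<epsilon> :: real and \<F> :: "'a bigraph set"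
  assumes "0 < \<epsilon>" and "\<epsilon> \<le> 1 / 2"
    and "\<forall>F\<in>\<F>. bicolored F"
  shows "(ex_density \<epsilon> \<F> < 1 \<longleftrightarrow> ramsey_number \<epsilon> \<F> < \<infinity>) \<and>
         (ramsey_number \<epsilon> \<F> < \<infinity> \<longleftrightarrow>
           (\<forall>c. \<exists>F\<in>\<F>. \<exists>G\<in>\<F>.
             (\<exists>t. \<exists>H :: nat bigraph. unavoidable_type1 c t H \<and> contains H F) \<and>
             (\<exists>t. \<exists>H :: nat bigraph. unavoidable_type2 c t H \<and> contains H G)))"
proof -
  let ?R = "ramsey_number \<epsilon> \<F> < \<infinity>"
  have "?R" if "ex_density \<epsilon> \<F> < 1"
    using assms(1,2) that by (rule ramsey_number_finite_if_density_less_1)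
  moreover have "\<exists>F\<in>\<F>. split_member c two F" if ?R for c two
    using assms(2) that by (rule split_member_if_ramsey_number_finite)
  moreover have "ex_density \<epsilon> \<F> < 1" if "\<forall>c two. \<exists>F\<in>\<F>. split_member c two F"
  proof -
    have "\<exists>\<delta>>0. \<exists>m. \<forall>n\<ge>m. ex_ratio \<epsilon> \<F> n \<le> 1 - \<delta>"
      using assms(1) that by (intro ex_ratio_bounded_if_split_member) auto
    then obtain \<delta> m where "0 < \<delta>" "\<forall>n\<ge>m. ex_ratio \<epsilon> \<F> n \<le> 1 - \<delta>"
      by blast
    moreover from this have "ex_density \<epsilon> \<F> \<le> 1 - \<delta>"
      by (intro LIMSEQ_le_const2[OF ex_ratio_tendsto[OF assms(1,2)]]) blast
    ultimately show ?thesis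
      by linarith
  qed
  \<comment> \<open>For a fixed colour, \<open>F\<close> and \<open>G\<close> are chosen
    independently, so (3) splits into one condition for each colour and type.\<close>
  moreover have "(\<forall>c two. \<exists>F\<in>\<F>. split_member c two F) \<longleftrightarrow>
      (\<forall>c. \<exists>F\<in>\<F>. \<exists>G\<in>\<F>. split_member c False F \<and> split_member c True G)"
    by (metis (full_types))
  ultimately show ?thesis
    unfolding unavoidable_type1_contains_iff unavoidable_type2_contains_iff by blast
qed

end
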